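(* Let $n\ge 4$. a) Two algebras $L(\alpha_3,\alpha_4,\dots,\alpha_n,\theta)$ and $L'(\alpha_3',\alpha_4',\dots,\alpha_n',\theta')$ of the first family (with the same $n$) are isomorphic if and only if there exist $A,B\in\mathbb{C}$ such that $A(A+B)\neq 0$ and the following conditions hold: $$\alpha_3'=\frac{A+B}{A^2}\,\alpha_3,$$ $$\alpha_t'=\frac{1}{A^{t-1}}\Big((A+B)\alpha_t-\sum_{k=3}^{t-1}S_{k,t}(\alpha)\,\alpha_k'\Big),\qquad 4\le t\le n,$$ $$\theta'=\frac{1}{A^{n-1}}\Big(A\theta+B\alpha_n-\sum_{k=3}^{n-1}S_{k,n}(\alpha)\,\alpha_k'\Big).$$ b) Two algebras $L(\beta_3,\beta_4,\dots,\beta_n,\gamma)$ and $L'(\beta_3',\beta_4',\dots,\beta_n',\gamma')$ of the second family (with the same $n$) are isomorphic if and only if there exist $A,B,D\in\mathbb{C}$ such that $AD\neq 0$ and the following conditions hold: $$\gamma'=\frac{D^2}{A^n}\,\gamma,\qquad \beta_3'=\frac{D}{A^2}\,\beta_3,$$ $$\beta_t'=\frac{1}{A^{t-1}}\Big(D\beta_t-\sum_{k=3}^{t-1}S_{k,t}(\beta)\,\beta_k'\Big),\qquad 4\le t\le n-1,$$ $$\beta_n'=\frac{BD\gamma}{A^n}+\frac{1}{A^{n-1}}\Big(D\beta_n-\sum_{k=3}^{n-1}S_{k,n}(\beta)\,\beta_k'\Big).$$ Here, for a sequence $x=(x_3,\dots,x_n)$ of complex numbers and $3\le k<s\le n$,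 $$S_{k,s}(x)=\sum_{j=1}^{k-1}C_{k-1}^{k-1-j}A^{k-1-j}B^{j}\,T_{k,j,s}(x),$$ where $T_{k,1,s}(x)=x_{s+2-k}$ and, for $2\le j\le k-1$, $$T_{k,j,s}(x)=\sum_{i_{j-1}=k+j}^{s}\ \sum_{i_{j-2}=k+j}^{i_{j-1}}\cdots\sum_{i_1=k+j}^{i_2}x_{s+3-i_{j-1}}\,x_{i_{j-1}+3-i_{j-2}}\cdots x_{i_2+3-i_1}\,x_{i_1+3-k-j}$$ (for $j=2$ this is $\sum_{i_1=k+2}^{s}x_{s+3-i_1}x_{i_1+1-k}$; sums over empty ranges are $0$).
   Context: All algebras are over $\mathbb{C}$. A Leibniz algebra is a vector space with a bilinear product $[-,-]$ satisfying $[x,[y,z]]=[[x,y],z]-[[x,z],y]$. $C_s^t=\frac{s!}{(s-t)!\,t!}$ is the binomial coefficient. Products of basis elements that are not listed are zero. First family: $L(\alpha_3,\dots,\alpha_n,\theta)$, with $\alpha_3,\dots,\alpha_n,\theta\in\mathbb{C}$, is the $(n+1)$-dimensional Leibniz algebra with basis $\{e_0,e_1,\dots,e_n\}$ and products $[e_0,e_0]=e_2$; $[e_i,e_0]=e_{i+1}$ for $1\le i\le n-1$; $[e_0,e_1]=\alpha_3e_3+\alpha_4e_4+\dots+\alpha_{n-1}e_{n-1}+\theta e_n$; $[e_j,e_1]=\alpha_3e_{j+2}+\alpha_4e_{j+3}+\dots+\alpha_{n+1-j}e_n$ for $1\le j\le n-2$. Second family: $L(\beta_3,\dots,\beta_n,\gamma)$,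 with $\beta_3,\dots,\beta_n,\gamma\in\mathbb{C}$, is the $(n+1)$-dimensional Leibniz algebra with basis $\{e_0,e_1,\dots,e_n\}$ and products $[e_0,e_0]=e_2$; $[e_i,e_0]=e_{i+1}$ for $2\le i\le n-1$; $[e_0,e_1]=\beta_3e_3+\beta_4e_4+\dots+\beta_ne_n$; $[e_1,e_1]=\gamma e_n$; $[e_j,e_1]=\beta_3e_{j+2}+\beta_4e_{j+3}+\dots+\beta_{n+1-j}e_n$ for $2\le j\le n-2$. *)

theory Defs
  imports Complex_Main "HOL-Library.Function_Algebras"
begin

text \<open>All coordinate spaces are realised inside the complex vector space of sequences
  \<open>nat \<Rightarrow> complex\<close> (pointwise operations): \<open>coord_space n\<close> is
  the copy of the \<open>(n+1)\<close>-dimensional space with coordinates \<open>0, \<dots>, n\<close>.\<close>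

definition cscale :: "complex \<Rightarrow> (nat \<Rightarrow> complex) \<Rightarrow> nat \<Rightarrow> complex"  (infixr "*\<^sub>c" 75)
  where "c *\<^sub>c v = (\<lambda>i. c * v i)"

interpretation cseq: vector_space cscale
  by unfold_locales (auto simp: cscale_def fun_eq_iff algebra_simps)

interpretation cseq_pair: vector_space_pair cscale cscale ..

definition coord_space :: "nat \<Rightarrow> (nat \<Rightarrow> complex) set"
  where "coord_space n = {v. \<forall>i>n. v i = 0}"

definition e :: "nat \<Rightarrow> nat \<Rightarrow> complex"
  where "e i = (\<lambda>k. if k = i then 1 else 0)"

record cplx_algebra =
  carr :: "(nat \<Rightarrow> complex) set"
  brk  :: "(nat \<Rightarrow> complex) \<Rightarrow> (nat \<Rightarrow> complex) \<Rightarrow> nat \<Rightarrow> complex"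

definition leibniz_algebra :: "cplx_algebra \<Rightarrow> bool"
  where "leibniz_algebra L \<longleftrightarrow>
    cseq.subspace (carr L) \<and>
    (\<forall>x\<in>carr L. \<forall>y\<in>carr L. brk L x y \<in> carr L) \<and>
    (\<forall>x\<in>carr L. \<forall>y\<in>carr L. \<forall>z\<in>carr L. \<forall>a b.
        brk L (a *\<^sub>c x + b *\<^sub>c y) z = a *\<^sub>c brk L x z + b *\<^sub>c brk L y z \<and>
        brk L z (a *\<^sub>c x + b *\<^sub>c y) = a *\<^sub>c brk L z x + b *\<^sub>c brk L z y) \<and>
    (\<forall>x\<in>carr L. \<forall>y\<in>carr L. \<forall>z\<in>carr L.
        brk L x (brk L y z) = brk L (brk L x y) z - brk L (brk L x z) y)"

definition alg_isomorphic :: "cplx_algebra \<Rightarrow> cplx_algebra \<Rightarrow> bool"  (infix "\<simeq>" 50)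
  where "L \<simeq> M \<longleftrightarrow>
    (\<exists>f. bij_betw f (carr L) (carr M) \<and>
         (\<forall>x\<in>carr L. \<forall>y\<in>carr L. f (x + y) = f x + f y) \<and>
         (\<forall>c. \<forall>x\<in>carr L. f (c *\<^sub>c x) = c *\<^sub>c f x) \<and>
         (\<forall>x\<in>carr L. \<forall>y\<in>carr L. f (brk L x y) = brk M (f x) (f y)))"

text \<open>The algebra on \<open>coord_space n\<close> whose bracket extends the multiplication table
  \<open>[e i, e j] = P i j\<close> bilinearly.\<close>

definition table_algebra :: "nat \<Rightarrow> (nat \<Rightarrow> nat \<Rightarrow> nat \<Rightarrow> complex) \<Rightarrow> cplx_algebra"
  where "table_algebra n P =
    \<lparr>carr = coord_space n, brk = (\<lambda>x y. \<Sum>i\<le>n. \<Sum>j\<le>n. (x i * y j) *\<^sub>c P i j)\<rparr>"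

definition first_table ::
    "nat \<Rightarrow> (nat \<Rightarrow> complex) \<Rightarrow> complex \<Rightarrow> nat \<Rightarrow> nat \<Rightarrow> nat \<Rightarrow> complex"
  where "first_table n \<alpha> \<theta> i j =
    (if i = 0 \<and> j = 0 then e 2
     else if 1 \<le> i \<and> i \<le> n - 1 \<and> j = 0 then e (i + 1)
     else if i = 0 \<and> j = 1 then (\<Sum>t=3..n-1. \<alpha> t *\<^sub>c e t) + \<theta> *\<^sub>c e n
     else if 1 \<le> i \<and> i \<le> n - 2 \<and> j = 1 then (\<Sum>t=3..n+1-i. \<alpha> t *\<^sub>c e (t + i - 1))
     else 0)"

definition second_table ::
    "nat \<Rightarrow> (nat \<Rightarrow> complex) \<Rightarrow> complex \<Rightarrow> nat \<Rightarrow> nat \<Rightarrow> nat \<Rightarrow> complex"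
  where "second_table n \<beta> \<gamma> i j =
    (if i = 0 \<and> j = 0 then e 2
     else if 2 \<le> i \<and> i \<le> n - 1 \<and> j = 0 then e (i + 1)
     else if i = 0 \<and> j = 1 then (\<Sum>t=3..n. \<beta> t *\<^sub>c e t)
     else if i = 1 \<and> j = 1 then \<gamma> *\<^sub>c e n
     else if 2 \<le> i \<and> i \<le> n - 2 \<and> j = 1 then (\<Sum>t=3..n+1-i. \<beta> t *\<^sub>c e (t + i - 1))
     else 0)"

text \<open>The parameters \<open>x\<^sub>3, \<dots>, x\<^sub>n\<close> are given by a sequence \<open>x :: nat \<Rightarrow> complex\<close>,
  whose values outside \<open>{3..n}\<close> are never used.\<close>

definition L_first :: "nat \<Rightarrow> (nat \<Rightarrow> complex) \<Rightarrow> complex \<Rightarrow> cplx_algebra"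
  where "L_first n \<alpha> \<theta> = table_algebra n (first_table n \<alpha> \<theta>)"

definition L_second :: "nat \<Rightarrow> (nat \<Rightarrow> complex) \<Rightarrow> complex \<Rightarrow> cplx_algebra"
  where "L_second n \<beta> \<gamma> = table_algebra n (second_table n \<beta> \<gamma>)"

text \<open>\<open>nested_sum x c r m\<close> is the \<open>r\<close>-fold sum over \<open>c \<le> i\<^sub>1 \<le> \<dots> \<le> i\<^sub>r \<le> m\<close> of
  \<open>x (m+3-i\<^sub>r) * x (i\<^sub>r+3-i\<^sub>r\<^sub>-\<^sub>1) * \<dots> * x (i\<^sub>2+3-i\<^sub>1) * x (i\<^sub>1+3-c)\<close>, with each factor
  pulled out of the inner sums that do not involve it.  All indices of \<open>x\<close> are at least 3,
  so the subtractions do not truncate.\<close>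

fun nested_sum :: "(nat \<Rightarrow> complex) \<Rightarrow> nat \<Rightarrow> nat \<Rightarrow> nat \<Rightarrow> complex"
  where
    "nested_sum x c 0 m = x (m + 3 - c)"
  | "nested_sum x c (Suc r) m = (\<Sum>i=c..m. x (m + 3 - i) * nested_sum x c r i)"

definition T_coeff :: "nat \<Rightarrow> nat \<Rightarrow> nat \<Rightarrow> (nat \<Rightarrow> complex) \<Rightarrow> complex"
  where "T_coeff k j s x =
    (if j = 1 then x (s + 2 - k) else nested_sum x (k + j) (j - 1) s)"

definition S_coeff :: "complex \<Rightarrow> complex \<Rightarrow> nat \<Rightarrow> nat \<Rightarrow> (nat \<Rightarrow> complex) \<Rightarrow> complex"
  where "S_coeff A B k s x =
    (\<Sum>j=1..k-1. of_nat ((k - 1) choose (k - 1 - j)) * A ^ (k - 1 - j) * B ^ j * T_coeff k j s x)"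

text \<open>The two tables do define Leibniz algebras of dimension \<open>n+1\<close> with basis
  \<open>e 0, \<dots>, e n\<close> and the prescribed products.\<close>

lemma sum_fun_apply: "(\<Sum>i\<in>I. f i) k = (\<Sum>i\<in>I. f i (k::nat) :: complex)"
  by (induction I rule: infinite_finite_induct) auto

lemma subspace_coord_space: "cseq.subspace (coord_space n)"
  by (auto simp: cseq.subspace_def coord_space_def cscale_def)

lemma inj_e: "inj e"
  by (rule injI) (metis e_def zero_neq_one)

lemma coord_expansion: "v \<in> coord_space n \<Longrightarrow> v = (\<Sum>i\<le>n. v i *\<^sub>c e i)"
  by (auto simp: fun_eq_iff sum_fun_apply cscale_def e_def coord_space_def if_distrib
      cong: if_cong)

lemma span_e: "cseq.span (e ` {..n}) = coord_space n"
proof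
  show "cseq.span (e ` {..n}) \<subseteq> coord_space n"
    by (rule cseq.span_minimal[OF _ subspace_coord_space]) (auto simp: coord_space_def e_def)
  show "coord_space n \<subseteq> cseq.span (e ` {..n})"
  proof
    fix v assume "v \<in> coord_space n"
    then have "v = (\<Sum>i\<le>n. v i *\<^sub>c e i)" by (rule coord_expansion)
    also have "\<dots> \<in> cseq.span (e ` {..n})"
      by (intro cseq.span_sum cseq.span_scale cseq.span_base) auto
    finally show "v \<in> cseq.span (e ` {..n})" .
  qed
qed

lemma independent_e: "cseq.independent (e ` {..n})"
proof (rule cseq.independent_if_scalars_zero)
  fix f x assume *: "(\<Sum>y\<in>e ` {..n}. f y *\<^sub>c y) = 0" and "x \<in> e ` {..n}"
  then obtain i where i: "i \<le> n" "x = e i" by auto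
  have "(\<Sum>y\<in>e ` {..n}. f y *\<^sub>c y) = (\<Sum>j\<le>n. f (e j) *\<^sub>c e j)"
    by (subst sum.reindex) (auto intro: inj_on_subset[OF inj_e])
  then have "0 = (\<Sum>j\<le>n. f (e j) *\<^sub>c e j) i" using * by simp
  also have "\<dots> = f (e i)"
    using i by (simp add: sum_fun_apply cscale_def e_def if_distrib cong: if_cong)
  finally show "f x = 0" using i by simp
qed simp

lemma dim_coord_space: "cseq.dim (coord_space n) = n + 1"
proof -
  have "cseq.dim (coord_space n) = card (e ` {..n})"
    by (rule cseq.dim_eq_card[OF _ independent_e])
      (simp add: span_e cseq.span_eq_iff[THEN iffD2, OF subspace_coord_space])
  also have "\<dots> = n + 1" by (simp add: card_image inj_on_subset[OF inj_e])
  finally show ?thesis .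
qed

abbreviation table_brk ::
    "nat \<Rightarrow> (nat \<Rightarrow> nat \<Rightarrow> nat \<Rightarrow> complex) \<Rightarrow> (nat \<Rightarrow> complex) \<Rightarrow> (nat \<Rightarrow> complex) \<Rightarrow> nat \<Rightarrow> complex"
  where "table_brk n P \<equiv> brk (table_algebra n P)"

lemma table_brk_apply:
  "table_brk n P x y k = (\<Sum>i\<le>n. \<Sum>j\<le>n. x i * y j * P i j k)"
  by (simp add: table_algebra_def sum_fun_apply cscale_def)

lemma table_brk_basis:
  assumes "i \<le> n" "j \<le> n"
  shows "table_brk n P (e i) (e j) = P i j"
proof
  fix k
  have "table_brk n P (e i) (e j) k
      = (\<Sum>i'\<le>n. \<Sum>j'\<le>n. if j' = j then (if i' = i then P i' j' k else 0) else 0)"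
    unfolding table_brk_apply by (intro sum.cong) (auto simp: e_def)
  also have "\<dots> = P i j k" using assms by simp
  finally show "table_brk n P (e i) (e j) k = P i j k" .
qed

lemma linear_brk_left: "Vector_Spaces.linear cscale cscale (\<lambda>x. table_brk n P x y)"
  by unfold_locales
    (auto simp: fun_eq_iff table_brk_apply cscale_def algebra_simps sum.distrib sum_distrib_left)

lemma linear_brk_right: "Vector_Spaces.linear cscale cscale (\<lambda>y. table_brk n P x y)"
  by unfold_locales
    (auto simp: fun_eq_iff table_brk_apply cscale_def algebra_simps sum.distrib sum_distrib_left)

lemma leibniz_algebra_table:
  assumes P: "\<And>i j. i \<le> n \<Longrightarrow> j \<le> n \<Longrightarrow> P i j \<in> coord_space n"
    and P2: "\<And>i j. 2 \<le> j \<Longrightarrow> P i j = 0"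
    and P01: "\<And>i j k. i \<le> n \<Longrightarrow> j \<le> n \<Longrightarrow> k \<le> 1 \<Longrightarrow> P i j k = 0"
    and comm: "\<And>i. i \<le> n \<Longrightarrow> table_brk n P (P i 0) (e 1) = table_brk n P (P i 1) (e 0)"
  shows "leibniz_algebra (table_algebra n P)"
proof -
  let ?b = "table_brk n P"
  have lin_comp: "Vector_Spaces.linear cscale cscale (\<lambda>x. f (g x))"
    if "Vector_Spaces.linear cscale cscale f" "Vector_Spaces.linear cscale cscale g" for f g
    using Vector_Spaces.linear_compose[OF that(2) that(1)] by (simp add: o_def)
  note add = cseq_pair.linear_add[OF linear_brk_left] cseq_pair.linear_add[OF linear_brk_right]
  note scale = cseq_pair.linear_scale[OF linear_brk_left] cseq_pair.linear_scale[OF linear_brk_right]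
  have closed: "?b x y \<in> coord_space n" for x y
  proof -
    have "?b x y = (\<Sum>i\<le>n. \<Sum>j\<le>n. (x i * y j) *\<^sub>c P i j)" by (simp add: table_algebra_def)
    also have "\<dots> \<in> coord_space n"
      by (intro cseq.subspace_sum[OF subspace_coord_space]
          cseq.subspace_scale[OF subspace_coord_space] P) auto
    finally show ?thesis .
  qed
  have right0: "?b x w = 0" if "w 0 = 0" "w 1 = 0" for x w
  proof
    fix k
    have "x i * w j * P i j k = 0" for i j
      using that P2[of j i] by (cases "j = 0 \<or> j = 1") auto
    then show "?b x w k = 0 k"
      unfolding table_brk_apply zero_fun_apply by (intro sum.neutral ballI)
  qed
  have brk01: "?b x y 0 = 0 \<and> ?b x y 1 = 0" for x y
    using P01 by (simp add: table_brk_apply)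
  have basis: "?b (?b (e i) (e j)) (e k) = ?b (?b (e i) (e k)) (e j)"
    if ijk: "i \<le> n" "j \<le> n" "k \<le> n" for i j k
  proof -
    have zero: "?b 0 y = 0" for y by (rule cseq_pair.linear_0[OF linear_brk_left])
    have big: "?b x (e m) = 0" if "2 \<le> m" for m x
      using that by (intro right0) (auto simp: e_def)
    consider "2 \<le> j" | "2 \<le> k" | "j = k" | "j = 0" "k = 1" | "j = 1" "k = 0" by linarith
    then show ?thesis
    proof cases
      case 1 then show ?thesis by (simp add: big zero)
    next
      case 2 then show ?thesis by (simp add: big zero)
    next
      case 3 then show ?thesis by simp
    next
      case 4 with ijk comm[of i] show ?thesis by (simp add: table_brk_basis)
    next
      case 5 with ijk comm[of i] show ?thesis by (simp add: table_brk_basis)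
    qed
  qed
  have x: "?b (?b x (e j)) (e k) = ?b (?b x (e k)) (e j)"
    if "x \<in> coord_space n" "j \<le> n" "k \<le> n" for x j k
    by (rule cseq_pair.linear_eq_on[where B = "e ` {..n}" and x = x])
      (use that basis in \<open>auto simp: span_e intro!: lin_comp[OF linear_brk_left linear_brk_left]\<close>)
  have y: "?b (?b x y) (e k) = ?b (?b x (e k)) y"
    if "x \<in> coord_space n" "y \<in> coord_space n" "k \<le> n" for x y k
    by (rule cseq_pair.linear_eq_on[where B = "e ` {..n}" and x = y])
      (use that x in \<open>auto simp: span_e intro!: lin_comp[OF linear_brk_left] linear_brk_right\<close>)
  have z: "?b (?b x y) z = ?b (?b x z) y"
    if "x \<in> coord_space n" "y \<in> coord_space n" "z \<in> coord_space n" for x y z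
    by (rule cseq_pair.linear_eq_on[where B = "e ` {..n}" and x = z])
      (use that y in \<open>auto simp: span_e intro!: lin_comp[OF linear_brk_left] linear_brk_right\<close>)
  have carr: "carr (table_algebra n P) = coord_space n" by (simp add: table_algebra_def)
  show ?thesis
    unfolding leibniz_algebra_def carr
    using subspace_coord_space closed z right0 brk01 by (auto simp: add scale)
qed

lemma shift_sum_apply:
  assumes "1 \<le> i"
  shows "(\<Sum>t=3..n+1-i. \<alpha> t *\<^sub>c e (t + i - 1)) k
    = (if i + 2 \<le> k \<and> k \<le> n then \<alpha> (k + 1 - i) else 0)"
proof -
  have "(\<Sum>t=3..n+1-i. \<alpha> t *\<^sub>c e (t + i - 1)) k
      = (\<Sum>t=3..n+1-i. if t = k + 1 - i then (if i \<le> k then \<alpha> t else 0) else 0)"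
    unfolding sum_fun_apply using assms by (intro sum.cong) (auto simp: cscale_def e_def)
  also have "\<dots> = (if i + 2 \<le> k \<and> k \<le> n then \<alpha> (k + 1 - i) else 0)"
    using assms by (auto simp: sum.delta)
  finally show ?thesis .
qed

lemma initial_sum_apply:
  "(\<Sum>t=3..m. \<alpha> t *\<^sub>c e t) k = (if 3 \<le> k \<and> k \<le> m then \<alpha> k else 0)"
proof -
  have "(\<Sum>t=3..m. \<alpha> t *\<^sub>c e t) k = (\<Sum>t=3..m. if t = k then \<alpha> t else 0)"
    unfolding sum_fun_apply by (intro sum.cong) (auto simp: cscale_def e_def)
  then show ?thesis by simp
qed

lemma table_brk_e0:
  assumes col: "\<And>i. 2 \<le> i \<Longrightarrow> i \<le> n \<Longrightarrow> P i 0 = (if i < n then e (i + 1) else 0)"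
    and v: "v 0 = 0" "v 1 = 0"
  shows "table_brk n P v (e 0) k = (if 3 \<le> k \<and> k \<le> n then v (k - 1) else 0)"
proof -
  have "table_brk n P v (e 0) k
      = (\<Sum>i\<le>n. \<Sum>j\<le>n. if j = 0 then v i * P i j k else 0)"
    unfolding table_brk_apply by (intro sum.cong) (auto simp: e_def)
  also have "\<dots> = (\<Sum>i\<le>n. v i * P i 0 k)" by simp
  also have "\<dots> = (\<Sum>i\<le>n. if i = k - 1 then (if 3 \<le> k \<and> k \<le> n then v i else 0) else 0)"
  proof (intro sum.cong refl)
    fix i assume "i \<in> {..n}"
    show "v i * P i 0 k = (if i = k - 1 then (if 3 \<le> k \<and> k \<le> n then v i else 0) else 0)"
    proof (cases "2 \<le> i")
      case True
      then show ?thesis using col[of i] \<open>i \<in> {..n}\<close> by (auto simp: e_def)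
    next
      case False
      then have "i = 0 \<or> i = 1" by linarith
      then show ?thesis using v by auto
    qed
  qed
  also have "\<dots> = (if 3 \<le> k \<and> k \<le> n then v (k - 1) else 0)" by auto
  finally show ?thesis .
qed

lemma first_table_e1_apply:
  assumes "4 \<le> n"
  shows "first_table n \<alpha> \<theta> i (Suc 0) k =
    (if i = 0 then (if k = n then \<theta> else if 3 \<le> k \<and> k < n then \<alpha> k else 0)
     else if i + 2 \<le> k \<and> k \<le> n then \<alpha> (k + 1 - i) else 0)"
proof -
  consider "i = 0" | "1 \<le> i" "i \<le> n - 2" | "n - 2 < i" by linarith
  then show ?thesis
  proof cases
    case 1
    have "first_table n \<alpha> \<theta> i (Suc 0) = (\<Sum>t=3..n-1. \<alpha> t *\<^sub>c e t) + \<theta> *\<^sub>c e n"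
      using 1 by (simp add: first_table_def)
    then show ?thesis
      using 1 assms by (simp only: plus_fun_apply initial_sum_apply) (auto simp: e_def cscale_def)
  next
    case 2
    have "first_table n \<alpha> \<theta> i (Suc 0) = (\<Sum>t=3..n+1-i. \<alpha> t *\<^sub>c e (t + i - 1))"
      using 2 by (simp add: first_table_def)
    then show ?thesis using 2 by (simp only: shift_sum_apply) auto
  next
    case 3
    then show ?thesis using assms by (auto simp: first_table_def)
  qed
qed

lemma second_table_e1_apply:
  assumes "4 \<le> n"
  shows "second_table n \<beta> \<gamma> i (Suc 0) k =
    (if i = 0 then (if 3 \<le> k \<and> k \<le> n then \<beta> k else 0)
     else if i = 1 then (if k = n then \<gamma> else 0)
     else if i + 2 \<le> k \<and> k \<le> n then \<beta> (k + 1 - i) else 0)"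
proof -
  consider "i = 0" | "i = 1" | "2 \<le> i" "i \<le> n - 2" | "n - 2 < i" "2 \<le> i" by linarith
  then show ?thesis
  proof cases
    case 1
    have "second_table n \<beta> \<gamma> i (Suc 0) = (\<Sum>t=3..n. \<beta> t *\<^sub>c e t)"
      using 1 by (simp add: second_table_def)
    then show ?thesis using 1 by (simp only: initial_sum_apply) auto
  next
    case 2
    then show ?thesis by (simp add: second_table_def e_def cscale_def)
  next
    case 3
    have "second_table n \<beta> \<gamma> i (Suc 0) = (\<Sum>t=3..n+1-i. \<beta> t *\<^sub>c e (t + i - 1))"
      using 3 by (simp add: second_table_def)
    then show ?thesis using 3 by (simp only: shift_sum_apply) auto
  next
    case 4
    then show ?thesis using assms by (auto simp: second_table_def)
  qed
qed

lemma first_table_apply: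
  assumes "4 \<le> n"
  shows "first_table n \<alpha> \<theta> i j k =
    (if j = 0 then (if i = 0 then e 2 k else if i < n then e (i + 1) k else 0)
     else if j = 1 then first_table n \<alpha> \<theta> i 1 k else 0)"
  using assms by (auto simp: first_table_def)

lemma second_table_apply:
  assumes "4 \<le> n"
  shows "second_table n \<beta> \<gamma> i j k =
    (if j = 0 then (if i = 0 then e 2 k else if 2 \<le> i \<and> i < n then e (i + 1) k else 0)
     else if j = 1 then second_table n \<beta> \<gamma> i 1 k else 0)"
  using assms by (auto simp: second_table_def)

lemma leibniz_algebra_L_first:
  assumes "4 \<le> n"
  shows "leibniz_algebra (L_first n \<alpha> \<theta>)"
  unfolding L_first_def
proof (rule leibniz_algebra_table)
  let ?P = "first_table n \<alpha> \<theta>"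
  show "?P i j \<in> coord_space n" if "i \<le> n" "j \<le> n" for i j
    using assms that by (simp add: coord_space_def first_table_apply[OF assms, of _ _ i j] first_table_e1_apply[OF assms] e_def)
  show "?P i j = 0" if "2 \<le> j" for i j
    using that by (auto simp: first_table_def)
  show P01: "?P i j k = 0" if "i \<le> n" "j \<le> n" "k \<le> 1" for i j k
    using assms that by (simp add: first_table_apply[OF assms, of _ _ i j] first_table_e1_apply[OF assms] e_def)
  fix i assume i: "i \<le> n"
  show "table_brk n ?P (?P i 0) (e 1) = table_brk n ?P (?P i 1) (e 0)"
  proof
    fix k
    have r: "table_brk n ?P (?P i 1) (e 0) k = (if 3 \<le> k \<and> k \<le> n then ?P i 1 (k - 1) else 0)"
      using assms i by (intro table_brk_e0 P01) (auto simp: first_table_def)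
    show "table_brk n ?P (?P i 0) (e 1) k = table_brk n ?P (?P i 1) (e 0) k"
    proof (cases "i < n")
      case True
      define m where "m = (if i = 0 then 2 else i + 1)"
      have "?P i 0 = e m" using True assms by (auto simp: first_table_def m_def)
      then have "table_brk n ?P (?P i 0) (e 1) k = ?P m 1 k"
        using True assms by (simp add: table_brk_basis m_def)
      also have "\<dots> = (if 3 \<le> k \<and> k \<le> n then ?P i 1 (k - 1) else 0)"
        using True assms
        by (auto simp: first_table_e1_apply[OF assms] m_def)
      finally show ?thesis using r by simp
    next
      case False
      then have "?P i 0 = 0" "?P i 1 = 0" using i assms by (auto simp: first_table_def)
      then show ?thesis by (simp add: table_brk_apply)
    qed
  qed
qed

lemma leibniz_algebra_L_second:
  assumes "4 \<le> n"
  shows "leibniz_algebra (L_second n \<beta> \<gamma>)"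
  unfolding L_second_def
proof (rule leibniz_algebra_table)
  let ?P = "second_table n \<beta> \<gamma>"
  show "?P i j \<in> coord_space n" if "i \<le> n" "j \<le> n" for i j
    using assms that by (simp add: coord_space_def second_table_apply[OF assms, of _ _ i j] second_table_e1_apply[OF assms] e_def)
  show "?P i j = 0" if "2 \<le> j" for i j
    using that by (auto simp: second_table_def)
  show P01: "?P i j k = 0" if "i \<le> n" "j \<le> n" "k \<le> 1" for i j k
    using assms that by (simp add: second_table_apply[OF assms, of _ _ i j] second_table_e1_apply[OF assms] e_def)
  fix i assume i: "i \<le> n"
  show "table_brk n ?P (?P i 0) (e 1) = table_brk n ?P (?P i 1) (e 0)"
  proof
    fix k
    have r: "table_brk n ?P (?P i 1) (e 0) k = (if 3 \<le> k \<and> k \<le> n then ?P i 1 (k - 1) else 0)"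
      using assms i by (intro table_brk_e0 P01) (auto simp: second_table_def)
    show "table_brk n ?P (?P i 0) (e 1) k = table_brk n ?P (?P i 1) (e 0) k"
    proof (cases "i < n \<and> i \<noteq> 1")
      case True
      define m where "m = (if i = 0 then 2 else i + 1)"
      have "?P i 0 = e m" using True assms by (auto simp: second_table_def m_def)
      then have "table_brk n ?P (?P i 0) (e 1) k = ?P m 1 k"
        using True assms by (simp add: table_brk_basis m_def)
      also have "\<dots> = (if 3 \<le> k \<and> k \<le> n then ?P i 1 (k - 1) else 0)"
        using True assms
        by (auto simp: second_table_e1_apply[OF assms] m_def)
      finally show ?thesis using r by simp
    next
      case False
      then have "?P i 0 = 0" "k \<le> n \<Longrightarrow> ?P i 1 (k - 1) = 0" if "3 \<le> k"
        using i assms that by (auto simp: second_table_def e_def cscale_def)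
      moreover have "?P i 0 = 0" using False i assms by (auto simp: second_table_def)
      ultimately show ?thesis using r by (auto simp: table_brk_apply)
    qed
  qed
qed

lemma L_first_basis_products:
  "i \<le> n \<Longrightarrow> j \<le> n \<Longrightarrow> brk (L_first n \<alpha> \<theta>) (e i) (e j) = first_table n \<alpha> \<theta> i j"
  by (simp add: L_first_def table_brk_basis)

lemma L_second_basis_products:
  "i \<le> n \<Longrightarrow> j \<le> n \<Longrightarrow> brk (L_second n \<beta> \<gamma>) (e i) (e j) = second_table n \<beta> \<gamma> i j"
  by (simp add: L_second_def table_brk_basis)

end

theory Submission
  imports Defs "HOL-Computational_Algebra.Formal_Power_Series"
begin

text \<open>In both families an algebra is a line plus a cyclic module. Right multiplication by \<open>y\<close>
  depends only on the coordinates \<open>y\<^sub>0, y\<^sub>1\<close>, and there are a generator \<open>g\<close> and a vector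
  \<open>u\<close> (for the first family \<open>g = e\<^sub>1\<close>, \<open>u = e\<^sub>0 - e\<^sub>1\<close>, for the second \<open>g = e\<^sub>0\<close>, \<open>u = e\<^sub>1\<close>) such that
  the algebra is the line through \<open>u\<close> plus a copy of \<open>\<complex>[X]/(X\<^sup>n)\<close> generated by \<open>g\<close>. On the
  module \<open>e\<^sub>0\<close> acts on the right as \<open>X\<close> and \<open>e\<^sub>1\<close> as the series \<open>\<Phi> = \<Sum> x\<^sub>t X\<^sup>t\<^sup>-\<^sup>1\<close> of the parameters;
  moreover \<open>[u, e\<^sub>0] = 0\<close> and \<open>[u, e\<^sub>1] = \<delta> X\<^sup>n\<^sup>-\<^sup>1 g\<close>, where \<open>\<delta>\<close> is \<open>\<theta> - \<alpha>\<^sub>n\<close>, respectively \<open>\<gamma>\<close>.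

  Let \<open>f\<close> be an isomorphism from the primed to the unprimed algebra, and let \<open>f e\<^sub>0\<close> have first
  coordinates \<open>A, B\<close> and \<open>f e\<^sub>1\<close> first coordinates \<open>C, D\<close>. Then \<open>f\<close> turns multiplication by \<open>X\<close>
  into multiplication by \<open>\<psi> = A X + B \<Phi>\<close> and multiplication by \<open>\<Phi>'\<close> into multiplication by
  \<open>C X + D \<Phi>\<close>. Since \<open>\<Phi>'\<close> has order at least 2 this forces \<open>C = 0\<close> and, up to a
  correction in degree \<open>n - 1\<close> that comes from \<open>\<delta>\<close>, the equation
  \<open>\<Phi>' \<circ> \<psi> = D \<Phi>\<close> modulo \<open>X\<^sup>n\<close>. The image of \<open>[u, e\<^sub>1]\<close> relates \<open>\<delta>'\<close> to \<open>\<delta>\<close>. Conversely, substitution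
  of \<open>\<psi>\<close> for \<open>X\<close> is an automorphism of \<open>\<complex>[X]/(X\<^sup>n)\<close>, so any solution of these
  equations gives an isomorphism, after an adjustment in degree \<open>n - 2\<close> that makes it respect
  the products with \<open>e\<^sub>0\<close>.
  Both directions are proved for the two families at once, as
  \<open>isomorphic_iff_iso_data\<close>.

  The formulas of the theorem are the coefficients of the composition equation: by the binomial
  theorem \<open>S\<^sub>k\<^sub>,\<^sub>t\<close> is the coefficient of \<open>X\<^sup>t\<^sup>-\<^sup>1\<close> in \<open>\<psi>\<^sup>k\<^sup>-\<^sup>1\<close>, because the nested sums \<open>T\<^sub>k\<^sub>,\<^sub>j\<^sub>,\<^sub>t\<close> are
  coefficients of \<open>\<Phi>\<^sup>j\<close> (\<open>S_coeff_eq_power_nth\<close>); the diagonal term \<open>k = t\<close>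
  contributes \<open>A\<^sup>t\<^sup>-\<^sup>1\<close>, so the equation can be solved for the primed parameters one after the
  other.\<close>

unbundle fps_syntax

section \<open>Power series modulo a power of the variable\<close>

definition cong_upto :: "complex fps \<Rightarrow> nat \<Rightarrow> complex fps \<Rightarrow> bool"  ("_ \<approx>\<^bsub>_\<^esub> _" [51, 0, 51] 50)
  where "p \<approx>\<^bsub>n\<^esub> q \<longleftrightarrow> fps_X ^ n dvd p - q"

lemma fps_X_power_dvd_iff: "fps_X ^ n dvd (p :: complex fps) \<longleftrightarrow> (\<forall>m<n. p $ m = 0)"
proof
  assume "fps_X ^ n dvd p"
  then show "\<forall>m<n. p $ m = 0" by (auto simp: dvd_def fps_X_power_mult_nth)
next
  assume "\<forall>m<n. p $ m = 0"
  then have "p = fps_X ^ n * fps_shift n p"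
    by (simp add: fps_eq_iff fps_X_power_mult_nth)
  then show "fps_X ^ n dvd p" by (rule dvdI)
qed

lemma cong_upto_iff_nth: "p \<approx>\<^bsub>n\<^esub> q \<longleftrightarrow> (\<forall>m<n. p $ m = q $ m)"
  by (simp add: cong_upto_def fps_X_power_dvd_iff)

lemma cong_upto_refl [simp]: "p \<approx>\<^bsub>n\<^esub> p"
  by (simp add: cong_upto_def)

lemma cong_upto_sym: "p \<approx>\<^bsub>n\<^esub> q \<Longrightarrow> q \<approx>\<^bsub>n\<^esub> p"
  by (simp add: cong_upto_iff_nth)

lemma cong_upto_trans [trans]: "p \<approx>\<^bsub>n\<^esub> q \<Longrightarrow> q \<approx>\<^bsub>n\<^esub> r \<Longrightarrow> p \<approx>\<^bsub>n\<^esub> r"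
  by (simp add: cong_upto_iff_nth)

lemma cong_upto_add: "p \<approx>\<^bsub>n\<^esub> p' \<Longrightarrow> q \<approx>\<^bsub>n\<^esub> q' \<Longrightarrow> p + q \<approx>\<^bsub>n\<^esub> p' + q'"
  by (simp add: cong_upto_iff_nth)

lemma cong_upto_diff: "p \<approx>\<^bsub>n\<^esub> p' \<Longrightarrow> q \<approx>\<^bsub>n\<^esub> q' \<Longrightarrow> p - q \<approx>\<^bsub>n\<^esub> p' - q'"
  by (simp add: cong_upto_iff_nth)

lemma cong_upto_mult_left: "q \<approx>\<^bsub>n\<^esub> q' \<Longrightarrow> p * q \<approx>\<^bsub>n\<^esub> p * q'"
  by (simp add: cong_upto_def flip: right_diff_distrib)

lemma cong_upto_sum: "(\<And>i. i \<in> I \<Longrightarrow> p i \<approx>\<^bsub>n\<^esub> q i) \<Longrightarrow> (\<Sum>i\<in>I. p i) \<approx>\<^bsub>n\<^esub> (\<Sum>i\<in>I. q i)"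
  by (simp add: cong_upto_iff_nth fps_sum_nth)

lemma cong_upto_cancel_unit:
  assumes "r $ 0 \<noteq> 0" "p * r \<approx>\<^bsub>n\<^esub> q * r"
  shows "p \<approx>\<^bsub>n\<^esub> q"
  using assms by (simp add: cong_upto_def dvd_mult_unit_iff flip: left_diff_distrib)

text \<open>The socle of \<open>\<complex>[X]/(X\<^sup>n)\<close> is spanned by \<open>X\<^sup>n\<^sup>-\<^sup>1\<close>: every series acts on it through its
  constant term.\<close>
lemma cong_upto_top_mult: "1 \<le> n \<Longrightarrow> fps_X ^ (n - 1) * p \<approx>\<^bsub>n\<^esub> fps_const (p $ 0) * fps_X ^ (n - 1)"
  by (auto simp: cong_upto_iff_nth fps_X_power_mult_nth less_diff_conv fps_X_power_nth)

text \<open>A series of order one is \<open>X\<close> times a unit, so cancelling it loses exactly one degree of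
  precision.\<close>
lemma dvd_order_one_cancel:
  fixes a w :: "complex fps"
  assumes "a $ 0 = 0" "a $ 1 \<noteq> 0" "fps_X ^ Suc n dvd a * w"
  shows "fps_X ^ n dvd w"
proof -
  have "a = fps_X * fps_shift 1 a"
    using assms(1) by (simp add: fps_eq_iff)
  then have "fps_X * fps_X ^ n dvd fps_X * (w * fps_shift 1 a)"
    using assms(3) by (metis mult.assoc mult.commute power_Suc)
  then have "fps_X ^ n dvd w * fps_shift 1 a"
    by (simp only: dvd_times_left_cancel_iff[OF fps_X_neq_zero])
  then show ?thesis using assms(2) by (simp add: dvd_mult_unit_iff)
qed

lemma power_order_one_mult_nth:
  fixes a p :: "complex fps"
  assumes "a $ 0 = 0"
  shows "(a ^ m * p) $ m = (a $ 1) ^ m * p $ 0"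
proof -
  have "(a ^ m * p) $ m = (\<Sum>i=0..m. if i = m then (a ^ m $ m) * p $ 0 else 0)"
    unfolding fps_mult_nth using assms
    by (intro sum.cong) (auto simp: startsby_zero_power_prefix)
  then show ?thesis using assms by (simp add: startsby_zero_power_nth_same)
qed

lemma power_order_one_dvd:
  fixes a :: "complex fps"
  assumes "a $ 0 = 0"
  shows "fps_X ^ m dvd a ^ m"
  using startsby_zero_power_prefix[OF assms] by (simp add: fps_X_power_dvd_iff)

lemma cong_upto_compose:
  assumes "a $ 0 = 0" "p \<approx>\<^bsub>n\<^esub> q"
  shows "p oo a \<approx>\<^bsub>n\<^esub> q oo a"
  using assms by (simp add: cong_upto_iff_nth fps_compose_nth)

text \<open>Powers \<open>a\<^sup>t\<close> with \<open>t \<ge> n\<close> vanish modulo \<open>X\<^sup>n\<close>, which makes substitution a finite linear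
  combination; linear maps can then be applied to it.\<close>
lemma compose_cong_upto_sum:
  assumes "a $ 0 = 0"
  shows "p oo a \<approx>\<^bsub>n\<^esub> (\<Sum>t<n. fps_const (p $ t) * a ^ t)"
proof -
  have "(\<Sum>t<n. p $ t * a ^ t $ m) = (\<Sum>t=0..m. p $ t * a ^ t $ m)" if "m < n" for m
    using that startsby_zero_power_prefix[OF assms] by (intro sum.mono_neutral_right) auto
  then show ?thesis by (simp add: cong_upto_iff_nth fps_compose_nth fps_sum_nth)
qed

section \<open>The structure coefficients as coefficients of powers\<close>

text \<open>The shift by one is the one between the basis and the powers of \<open>X\<close>: in the module,
  \<open>X\<^sup>m\<close> stands for \<open>e\<^sub>m\<^sub>+\<^sub>1\<close> when \<open>m \<ge> 1\<close>.\<close>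
definition param_series :: "(nat \<Rightarrow> complex) \<Rightarrow> complex fps"
  where "param_series x = Abs_fps (\<lambda>m. if m < 2 then 0 else x (m + 1))"

lemma param_series_nth: "param_series x $ m = (if m < 2 then 0 else x (m + 1))"
  by (simp add: param_series_def)

lemma param_series_factor: "param_series x = fps_X ^ 2 * Abs_fps (\<lambda>m. x (m + 3))"
proof (rule fps_ext)
  fix m
  show "param_series x $ m = (fps_X ^ 2 * Abs_fps (\<lambda>m. x (m + 3))) $ m"
    unfolding fps_X_power_mult_nth param_series_nth by (auto intro!: arg_cong[of _ _ x])
qed

text \<open>Each summation of \<open>nested_sum\<close> is a Cauchy product with \<open>\<Xi> = \<Sum> x\<^sub>i\<^sub>+\<^sub>3 X\<^sup>i\<close>: the lower limit
  \<open>c\<close> is the origin of the degrees.\<close>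
lemma nested_sum_eq_power_nth:
  assumes "c \<le> m"
  shows "nested_sum x c r m = (Abs_fps (\<lambda>i. x (i + 3)) ^ Suc r) $ (m - c)"
  using assms
proof (induction r arbitrary: m)
  case 0
  then show ?case by simp
next
  case (Suc r)
  let ?\<Xi> = "Abs_fps (\<lambda>i. x (i + 3))"
  have "nested_sum x c (Suc r) m = (\<Sum>i=c..m. x (m - i + 3) * (?\<Xi> ^ Suc r) $ (i - c))"
    unfolding nested_sum.simps by (intro sum.cong) (auto simp: Suc.IH simp del: power_Suc)
  also have "\<dots> = (\<Sum>i=0..m-c. x (i + 3) * (?\<Xi> ^ Suc r) $ (m - c - i))"
    using Suc.prems
    by (intro sum.reindex_bij_witness[where i = "\<lambda>i. m - i" and j = "\<lambda>i. m - i"])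
      (auto simp del: power_Suc)
  also have "\<dots> = (?\<Xi> * ?\<Xi> ^ Suc r) $ (m - c)"
    unfolding fps_mult_nth by simp
  finally show ?case by simp
qed

text \<open>Since \<open>\<Phi> = X\<^sup>2 \<Xi>\<close>, the power \<open>\<Phi>\<^sup>j\<close> starts in degree \<open>2 j\<close>, and the sums with an empty range are
  the coefficients below that degree.\<close>
lemma T_coeff_eq_power_nth:
  assumes "1 \<le> j" "k < s"
  shows "T_coeff k j s x = (param_series x ^ j) $ (s + j - k)"
proof (cases "j = 1")
  case True
  then show ?thesis using assms by (simp add: T_coeff_def param_series_nth Suc_diff_le less_imp_le)
next
  case False
  let ?\<Xi> = "Abs_fps (\<lambda>i. x (i + 3))"
  obtain r where r: "j = Suc (Suc r)" using assms False by (cases j; cases "j - 1") auto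
  have power: "(param_series x ^ j) $ (s + j - k)
      = (if s + j - k < 2 * j then 0 else (?\<Xi> ^ j) $ (s + j - k - 2 * j))"
    unfolding param_series_factor power_mult_distrib power_mult[symmetric] fps_X_power_mult_nth ..
  show ?thesis
  proof (cases "k + j \<le> s")
    case True
    then have "T_coeff k j s x = (?\<Xi> ^ j) $ (s - (k + j))"
      using False assms nested_sum_eq_power_nth[of "k + j" s x "j - 1"]
      by (simp add: T_coeff_def del: power_Suc)
    moreover have "s - (k + j) = s + j - k - 2 * j" "\<not> s + j - k < 2 * j" using True by auto
    ultimately show ?thesis using power by simp
  next
    case False
    then have "T_coeff k j s x = 0" using r by (simp add: T_coeff_def)
    moreover have "s + j - k < 2 * j" using False assms by auto
    ultimately show ?thesis using power by simp
  qed
qed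

lemma S_coeff_eq_power_nth:
  assumes "1 \<le> k" "k < s"
  shows "S_coeff A B k s x
    = ((fps_const A * fps_X + fps_const B * param_series x) ^ (k - 1)) $ (s - 1)"
proof -
  let ?\<Phi> = "param_series x"
  have "((fps_const A * fps_X + fps_const B * ?\<Phi>) ^ (k - 1))
      = (fps_const B * ?\<Phi> + fps_const A * fps_X) ^ (k - 1)" by (simp add: add.commute)
  also have "\<dots> = (\<Sum>j\<le>k-1. of_nat ((k - 1) choose j)
        * (fps_const B * ?\<Phi>) ^ j * (fps_const A * fps_X) ^ (k - 1 - j))"
    by (rule binomial_ring)
  also have "\<dots> = (\<Sum>j\<le>k-1. fps_const (of_nat ((k - 1) choose j) * A ^ (k - 1 - j) * B ^ j)
        * (fps_X ^ (k - 1 - j) * ?\<Phi> ^ j))"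
    by (intro sum.cong) (simp_all add: power_mult_distrib fps_const_power fps_of_nat[symmetric] mult_ac
        flip: fps_const_mult)
  finally have "((fps_const A * fps_X + fps_const B * ?\<Phi>) ^ (k - 1)) $ (s - 1)
      = (\<Sum>j\<le>k-1. of_nat ((k - 1) choose j) * A ^ (k - 1 - j) * B ^ j
          * (if s - 1 < k - 1 - j then 0 else (?\<Phi> ^ j) $ (s - 1 - (k - 1 - j))))"
    by (simp only: fps_sum_nth fps_mult_left_const_nth fps_X_power_mult_nth)
  also have "\<dots> = (\<Sum>j=1..k-1. of_nat ((k - 1) choose j) * A ^ (k - 1 - j) * B ^ j
          * (if s - 1 < k - 1 - j then 0 else (?\<Phi> ^ j) $ (s - 1 - (k - 1 - j))))"
  proof (intro sum.mono_neutral_right ballI)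
    fix j assume "j \<in> {..k-1} - {1..k-1}"
    then have "j = 0" by auto
    then show "of_nat ((k - 1) choose j) * A ^ (k - 1 - j) * B ^ j
          * (if s - 1 < k - 1 - j then 0 else (?\<Phi> ^ j) $ (s - 1 - (k - 1 - j))) = 0"
      using assms by simp
  qed auto
  also have "\<dots> = S_coeff A B k s x"
    unfolding S_coeff_def
  proof (intro sum.cong refl)
    fix j assume j: "j \<in> {1..k-1}"
    then have "s - 1 - (k - 1 - j) = s + j - k" "\<not> s - 1 < k - 1 - j"
      "(k - 1) choose j = (k - 1) choose (k - 1 - j)"
      using assms binomial_symmetric[of j "k - 1"] by auto
    then show "of_nat ((k - 1) choose j) * A ^ (k - 1 - j) * B ^ j
          * (if s - 1 < k - 1 - j then 0 else (?\<Phi> ^ j) $ (s - 1 - (k - 1 - j)))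
        = of_nat ((k - 1) choose (k - 1 - j)) * A ^ (k - 1 - j) * B ^ j * T_coeff k j s x"
      using j assms by (simp add: T_coeff_eq_power_nth)
  qed
  finally show ?thesis by simp
qed

text \<open>Only \<open>k \<le> t\<close> contributes because \<open>\<psi> = A X + B \<Phi>\<close> has no constant term; the term \<open>k = t\<close> is the
  lowest coefficient \<open>A\<^sup>t\<^sup>-\<^sup>1\<close> of \<open>\<psi>\<^sup>t\<^sup>-\<^sup>1\<close>.\<close>
lemma param_series_compose_nth:
  assumes "3 \<le> t"
  shows "(param_series y oo (fps_const A * fps_X + fps_const B * param_series x)) $ (t - 1)
    = A ^ (t - 1) * y t + (\<Sum>k=3..t-1. S_coeff A B k t x * y k)"
proof -
  define \<psi> where "\<psi> = fps_const A * fps_X + fps_const B * param_series x"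
  have \<psi>: "\<psi> $ 0 = 0" "\<psi> $ 1 = A" by (simp_all add: \<psi>_def param_series_nth)
  have "(param_series y oo \<psi>) $ (t - 1) = (\<Sum>i=0..t-1. param_series y $ i * (\<psi> ^ i $ (t - 1)))"
    by (rule fps_compose_nth)
  also have "\<dots> = (\<Sum>i=2..t-1. y (i + 1) * (\<psi> ^ i $ (t - 1)))"
    by (rule sum.mono_neutral_cong_right) (auto simp: param_series_nth)
  also have "\<dots> = (\<Sum>k=3..t. y k * (\<psi> ^ (k - 1) $ (t - 1)))"
    by (rule sum.reindex_bij_witness[where i = "\<lambda>k. k - 1" and j = "\<lambda>i. i + 1"]) (use assms in auto)
  also have "{3..t} = insert t {3..t-1}" using assms by auto
  also have "(\<Sum>k\<in>insert t {3..t-1}. y k * (\<psi> ^ (k - 1) $ (t - 1)))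
      = y t * A ^ (t - 1) + (\<Sum>k=3..t-1. y k * (\<psi> ^ (k - 1) $ (t - 1)))"
    using assms startsby_zero_power_nth_same[OF \<psi>(1), of "t - 1"] \<psi>(2) by (subst sum.insert) auto
  also have "(\<Sum>k=3..t-1. y k * (\<psi> ^ (k - 1) $ (t - 1))) = (\<Sum>k=3..t-1. S_coeff A B k t x * y k)"
    unfolding \<psi>_def by (intro sum.cong refl, subst S_coeff_eq_power_nth) auto
  finally show ?thesis by (simp add: \<psi>_def)
qed

lemma param_series_compose_cong_iff:
  assumes "4 \<le> n"
  shows "param_series y oo (fps_const A * fps_X + fps_const B * param_series x)
      \<approx>\<^bsub>n\<^esub> fps_const D * param_series x + fps_const c * fps_X ^ (n - 1)
    \<longleftrightarrow> (\<forall>t\<in>{3..n}. A ^ (t - 1) * y t + (\<Sum>k=3..t-1. S_coeff A B k t x * y k)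
          = D * x t + (if t = n then c else 0))"
    (is "?p \<approx>\<^bsub>n\<^esub> ?q \<longleftrightarrow> (\<forall>t\<in>{3..n}. ?l t = ?r t)")
proof -
  have low: "?p $ m = ?q $ m" if "m < 2" for m
  proof -
    have "m = 0 \<or> m = 1" using that by auto
    then show ?thesis using assms
      by (auto simp: fps_compose_nth param_series_nth fps_X_power_nth)
  qed
  have high: "?p $ (t - 1) = ?q $ (t - 1) \<longleftrightarrow> ?l t = ?r t" if "t \<in> {3..n}" for t
    using that assms
    by (subst param_series_compose_nth) (auto simp: param_series_nth fps_X_power_nth)
  have "?p \<approx>\<^bsub>n\<^esub> ?q \<longleftrightarrow> (\<forall>t\<in>{3..n}. ?p $ (t - 1) = ?q $ (t - 1))"
  proof
    assume *: "\<forall>t\<in>{3..n}. ?p $ (t - 1) = ?q $ (t - 1)"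
    have "?p $ m = ?q $ m" if "m < n" for m
      using low[of m] *[rule_format, of "Suc m"] that by (cases "m < 2") auto
    then show "?p \<approx>\<^bsub>n\<^esub> ?q" by (simp add: cong_upto_iff_nth)
  qed (auto simp: cong_upto_iff_nth)
  also have "\<dots> \<longleftrightarrow> (\<forall>t\<in>{3..n}. ?l t = ?r t)" using high by blast
  finally show ?thesis .
qed

section \<open>Isomorphisms in module coordinates\<close>

text \<open>The formulas of the theorem describe an isomorphism from the primed algebra to the unprimed
  one, hence the need to reverse the direction.\<close>
lemma alg_isomorphic_sym:
  assumes "L \<simeq> M"
    and closed: "\<And>x y. x \<in> carr L \<Longrightarrow> y \<in> carr L \<Longrightarrow> x + y \<in> carr L \<and> brk L x y \<in> carr L"
      "\<And>c x. x \<in> carr L \<Longrightarrow> c *\<^sub>c x \<in> carr L"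
  shows "M \<simeq> L"
proof -
  obtain f where f: "bij_betw f (carr L) (carr M)"
    and add: "\<And>x y. x \<in> carr L \<Longrightarrow> y \<in> carr L \<Longrightarrow> f (x + y) = f x + f y"
    and scale: "\<And>c x. x \<in> carr L \<Longrightarrow> f (c *\<^sub>c x) = c *\<^sub>c f x"
    and brk: "\<And>x y. x \<in> carr L \<Longrightarrow> y \<in> carr L \<Longrightarrow> f (brk L x y) = brk M (f x) (f y)"
    using assms(1) unfolding alg_isomorphic_def by blast
  define g where "g = inv_into (carr L) f"
  have g: "bij_betw g (carr M) (carr L)"
    unfolding g_def by (rule bij_betw_inv_into[OF f])
  have gL: "g y \<in> carr L" if "y \<in> carr M" for y
    using g that by (auto simp: bij_betw_def)
  have fg: "f (g y) = y" if "y \<in> carr M" for y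
    unfolding g_def using f that by (simp add: bij_betw_def f_inv_into_f)
  have gf: "g (f x) = x" if "x \<in> carr L" for x
    unfolding g_def using f that by (simp add: bij_betw_def)
  show ?thesis
    unfolding alg_isomorphic_def
  proof (intro exI[of _ g] conjI ballI allI)
    fix x y assume "x \<in> carr M" "y \<in> carr M"
    then show "g (x + y) = g x + g y" "g (brk M x y) = brk L (g x) (g y)"
      using gf[of "g x + g y"] gf[of "brk L (g x) (g y)"] by (simp_all add: closed gL fg add brk)
  next
    fix c x assume "x \<in> carr M"
    then show "g (c *\<^sub>c x) = c *\<^sub>c g x"
      using gf[of "c *\<^sub>c g x"] by (simp add: closed gL fg scale)
  qed (rule g)
qed

text \<open>What the two families have in common: a vector \<open>v\<close> is given by its component \<open>d v\<close> along \<open>u\<close> and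
  its module component \<open>h v\<close>, read modulo \<open>X\<^sup>n\<close>; \<open>vec\<close> rebuilds the vector, so that \<open>u\<close> is
  \<open>vec 1 0\<close> and \<open>g\<close> is \<open>vec 0 1\<close>. The families differ in how the basis vectors \<open>e\<^sub>0\<close> and \<open>e\<^sub>1\<close> are
  combined from \<open>u\<close> and \<open>g\<close>, and this is the role of \<open>l0\<close> and \<open>l1\<close>: they give the coordinates 0 and
  1 of \<open>a u + b g\<close>.\<close>
locale truncated_coords =
  fixes n :: nat
    and d :: "(nat \<Rightarrow> complex) \<Rightarrow> complex"
    and h :: "(nat \<Rightarrow> complex) \<Rightarrow> complex fps"
    and vec :: "complex \<Rightarrow> complex fps \<Rightarrow> nat \<Rightarrow> complex"
    and l0 l1 :: "complex \<Rightarrow> complex \<Rightarrow> complex"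
  assumes n_ge_4: "4 \<le> n"
    and d_add: "d (v + w) = d v + d w"
    and d_scale: "d (c *\<^sub>c v) = c * d v"
    and h_add: "h (v + w) = h v + h w"
    and h_scale: "h (c *\<^sub>c v) = fps_const c * h v"
    and vec_in: "vec c p \<in> coord_space n"
    and d_vec: "d (vec c p) = c"
    and h_vec: "h (vec c p) \<approx>\<^bsub>n\<^esub> p"
    and coords_eqI: "v \<in> coord_space n \<Longrightarrow> w \<in> coord_space n \<Longrightarrow> d v = d w \<Longrightarrow> h v \<approx>\<^bsub>n\<^esub> h w \<Longrightarrow> v = w"
    and coord_0: "v 0 = l0 (d v) (h v $ 0)"
    and coord_1: "v 1 = l1 (d v) (h v $ 0)"
    and vec_const: "vec a (fps_const b) = l0 a b *\<^sub>c e 0 + l1 a b *\<^sub>c e 1"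
begin

text \<open>The algebra \<open>L\<close> in these coordinates: \<open>e\<^sub>0\<close> and \<open>e\<^sub>1\<close> multiply the module by \<open>X\<close> and \<open>\<Phi>\<close>, and
  \<open>[u, e\<^sub>1] = \<delta> X\<^sup>n\<^sup>-\<^sup>1\<close>.\<close>
definition presents :: "cplx_algebra \<Rightarrow> complex fps \<Rightarrow> complex \<Rightarrow> bool"
  where "presents L \<Phi> \<delta> \<longleftrightarrow> carr L = coord_space n \<and>
    (\<forall>x\<in>coord_space n. \<forall>y\<in>coord_space n. brk L x y \<in> coord_space n \<and> d (brk L x y) = 0 \<and>
      h (brk L x y) \<approx>\<^bsub>n\<^esub> (fps_const (y 0) * fps_X + fps_const (y 1) * \<Phi>) * h x
        + fps_const (y 1 * d x * \<delta>) * fps_X ^ (n - 1))"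

text \<open>The data of an isomorphism \<open>f\<close> from the algebra of \<open>(\<Phi>', \<delta>')\<close> to that of \<open>(\<Phi>, \<delta>)\<close>. The numbers
  \<open>P\<close> and \<open>Q\<close> are the \<open>u\<close>-components of \<open>f u\<close> and \<open>f g\<close>, and \<open>G\<close> is the constant term of the module
  component of \<open>f g\<close>; that of \<open>f u\<close> is zero. \<open>A, B\<close> and \<open>0, D\<close> are the first two coordinates of
  \<open>f e\<^sub>0\<close> and \<open>f e\<^sub>1\<close>. The quantified equations say that these two descriptions of \<open>f\<close> modulo the
  square of the algebra agree.\<close>
definition iso_data ::
    "complex fps \<Rightarrow> complex \<Rightarrow> complex fps \<Rightarrow> complex \<Rightarrow>
     complex \<Rightarrow> complex \<Rightarrow> complex \<Rightarrow> complex \<Rightarrow> complex \<Rightarrow> complex \<Rightarrow> bool"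
  where "iso_data \<Phi>' \<delta>' \<Phi> \<delta> A B D P Q G \<longleftrightarrow>
    A \<noteq> 0 \<and> P \<noteq> 0 \<and> G \<noteq> 0 \<and>
    (\<forall>a b. l0 (P * a + Q * b) (G * b) = A * l0 a b \<and>
           l1 (P * a + Q * b) (G * b) = B * l0 a b + D * l1 a b) \<and>
    \<Phi>' oo (fps_const A * fps_X + fps_const B * \<Phi>)
      \<approx>\<^bsub>n\<^esub> fps_const D * \<Phi> + fps_const (D * Q * \<delta> / G) * fps_X ^ (n - 1) \<and>
    G * \<delta>' * A ^ (n - 1) = D * P * \<delta>"

lemma zero_in: "0 \<in> coord_space n"
  and add_in: "v \<in> coord_space n \<Longrightarrow> w \<in> coord_space n \<Longrightarrow> v + w \<in> coord_space n"
  and scale_in: "v \<in> coord_space n \<Longrightarrow> c *\<^sub>c v \<in> coord_space n"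
  using subspace_coord_space by (auto simp: cseq.subspace_def)

lemma d_zero: "d 0 = 0" and h_zero: "h 0 = 0"
  using d_add[of 0 0] h_add[of 0 0] by simp_all

lemma h_nth_vec: "m < n \<Longrightarrow> h (vec c p) $ m = p $ m"
  using h_vec by (simp add: cong_upto_iff_nth)

lemma presentsD:
  assumes "presents L \<Phi> \<delta>" "x \<in> coord_space n" "y \<in> coord_space n"
  shows "brk L x y \<in> coord_space n" "d (brk L x y) = 0"
    "h (brk L x y) \<approx>\<^bsub>n\<^esub> (fps_const (y 0) * fps_X + fps_const (y 1) * \<Phi>) * h x
        + fps_const (y 1 * d x * \<delta>) * fps_X ^ (n - 1)"
  using assms by (auto simp: presents_def)

text \<open>The isomorphism is \<open>h (f v) = G (h v \<circ> \<psi>)\<close>, corrected by a multiple of \<open>X\<^sup>n\<^sup>-\<^sup>2\<close>. In the target,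
  right multiplication by \<open>f e\<^sub>0\<close> sends the \<open>u\<close>-component \<open>\<kappa>\<close> of a vector to \<open>B \<kappa> \<delta> X\<^sup>n\<^sup>-\<^sup>1\<close>, although
  \<open>[u, e\<^sub>0] = 0\<close> in the source. The term \<open>-(B \<delta> / A) \<kappa> X\<^sup>n\<^sup>-\<^sup>2\<close> cancels this contribution, because \<open>\<psi>\<close>
  multiplies it by \<open>A X\<close>, and it is annihilated by \<open>\<Phi>\<close>. Bijectivity comes from the compositional
  inverse of \<open>\<psi>\<close>.\<close>
lemma iso_data_imp_isomorphic:
  assumes L': "presents L' \<Phi>' \<delta>'" and L: "presents L \<Phi> \<delta>"
    and \<Phi>': "\<Phi>' $ 0 = 0" and \<Phi>: "\<Phi> $ 0 = 0" "\<Phi> $ 1 = 0"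
    and data: "iso_data \<Phi>' \<delta>' \<Phi> \<delta> A B D P Q G"
  shows "L' \<simeq> L"
proof -
  let ?S = "coord_space n"
  define \<psi> where "\<psi> = fps_const A * fps_X + fps_const B * \<Phi>"
  define K where "K = B * \<delta> / A"
  define \<kappa> where "\<kappa> v = P * d v + Q * h v $ 0" for v
  define F where "F v = fps_const G * (h v oo \<psi>) - fps_const (K * \<kappa> v) * fps_X ^ (n - 2)" for v
  define f where "f v = vec (\<kappa> v) (F v)" for v
  have A: "A \<noteq> 0" and P: "P \<noteq> 0" and G: "G \<noteq> 0"
    and l: "\<And>a b. l0 (P * a + Q * b) (G * b) = A * l0 a b"
      "\<And>a b. l1 (P * a + Q * b) (G * b) = B * l0 a b + D * l1 a b"
    and comp: "\<Phi>' oo \<psi> \<approx>\<^bsub>n\<^esub> fps_const D * \<Phi> + fps_const (D * Q * \<delta> / G) * fps_X ^ (n - 1)"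
    and \<delta>': "G * \<delta>' * A ^ (n - 1) = D * P * \<delta>"
    using data by (auto simp: iso_data_def \<psi>_def)
  have \<psi>0: "\<psi> $ 0 = 0" and \<psi>1: "\<psi> $ 1 = A"
    using \<Phi> by (simp_all add: \<psi>_def)
  have f_in: "f v \<in> ?S" for v by (simp add: f_def vec_in)
  have d_f: "d (f v) = \<kappa> v" for v by (simp add: f_def d_vec)
  have h_f: "h (f v) \<approx>\<^bsub>n\<^esub> F v" for v by (simp add: f_def h_vec)
  have h_f_0: "h (f v) $ 0 = G * h v $ 0" for v
    using n_ge_4 by (simp add: f_def h_nth_vec F_def)
  have f_0: "f v 0 = A * v 0" and f_1: "f v 1 = B * v 0 + D * v 1" for v
    unfolding coord_0[of "f v"] coord_1[of "f v"] d_f h_f_0 \<kappa>_def l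
    by (simp_all flip: coord_0 coord_1)
  have F_add: "F (v + w) = F v + F w" for v w
    unfolding F_def \<kappa>_def
    by (simp add: fps_eq_iff h_add d_add fps_compose_add_distrib algebra_simps add_divide_distrib)
  have F_scale: "F (c *\<^sub>c v) = fps_const c * F v" for c v
    unfolding F_def \<kappa>_def
    by (simp add: fps_eq_iff h_scale d_scale fps_const_mult_apply_left[symmetric] algebra_simps)
  have f_add: "f (v + w) = f v + f w" for v w
  proof (rule coords_eqI)
    show "h (f (v + w)) \<approx>\<^bsub>n\<^esub> h (f v + f w)"
      using h_f[of v] h_f[of w] h_f[of "v + w"] by (simp add: cong_upto_iff_nth F_add h_add)
    show "d (f (v + w)) = d (f v + f w)"
      by (simp add: d_f d_add \<kappa>_def h_add algebra_simps)
  qed (auto intro: f_in add_in)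
  have f_scale: "f (c *\<^sub>c v) = c *\<^sub>c f v" for c v
  proof (rule coords_eqI)
    show "h (f (c *\<^sub>c v)) \<approx>\<^bsub>n\<^esub> h (c *\<^sub>c f v)"
      using h_f[of v] h_f[of "c *\<^sub>c v"] by (simp add: cong_upto_iff_nth F_scale h_scale)
    show "d (f (c *\<^sub>c v)) = d (c *\<^sub>c f v)"
      by (simp add: d_f d_scale \<kappa>_def h_scale algebra_simps)
  qed (auto intro: f_in scale_in)
  have f_brk: "f (brk L' x y) = brk L (f x) (f y)" if xy: "x \<in> ?S" "y \<in> ?S" for x y
  proof (rule coords_eqI)
    note b' = presentsD[OF L' xy] and b = presentsD[OF L f_in f_in, of x y]
    show "f (brk L' x y) \<in> ?S" "brk L (f x) (f y) \<in> ?S" by (simp_all add: f_in b)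
    have "h (brk L' x y) $ 0 = 0"
      using b'(3) n_ge_4 \<Phi>' by (simp add: cong_upto_iff_nth)
    then have \<kappa>0: "\<kappa> (brk L' x y) = 0" by (simp add: \<kappa>_def b')
    then show "d (f (brk L' x y)) = d (brk L (f x) (f y))" by (simp add: d_f b)
    define u where "u = h x oo \<psi>"
    have top: "u * fps_X ^ (n - 1) \<approx>\<^bsub>n\<^esub> fps_const (h x $ 0) * fps_X ^ (n - 1)"
      using cong_upto_top_mult[of n u] n_ge_4 by (simp add: u_def mult.commute)
    have \<psi>n: "\<psi> ^ (n - 1) \<approx>\<^bsub>n\<^esub> fps_const (A ^ (n - 1)) * fps_X ^ (n - 1)"
      using startsby_zero_power_nth_same[OF \<psi>0, of "n - 1"] \<psi>1
        startsby_zero_power_prefix[OF \<psi>0, of "n - 1"]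
      by (auto simp: cong_upto_iff_nth fps_X_power_nth)
    have "h (f (brk L' x y)) \<approx>\<^bsub>n\<^esub> F (brk L' x y)" by (rule h_f)
    also have "F (brk L' x y) = fps_const G * (h (brk L' x y) oo \<psi>)" by (simp add: F_def \<kappa>0)
    also have "\<dots> \<approx>\<^bsub>n\<^esub> fps_const G * (((fps_const (y 0) * fps_X + fps_const (y 1) * \<Phi>') * h x
        + fps_const (y 1 * d x * \<delta>') * fps_X ^ (n - 1)) oo \<psi>)"
      by (intro cong_upto_mult_left cong_upto_compose b' \<psi>0)
    also have "\<dots> = fps_const G * ((fps_const (y 0) * \<psi> + fps_const (y 1) * (\<Phi>' oo \<psi>)) * u
        + fps_const (y 1 * d x * \<delta>') * \<psi> ^ (n - 1))"
      using \<psi>0 by (simp add: u_def fps_compose_add_distrib fps_compose_mult_distrib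
          fps_compose_power[symmetric] fps_X_fps_compose_startby0)
    also have "\<dots> = fps_const (G * y 0) * \<psi> * u + fps_const (G * y 1) * u * (\<Phi>' oo \<psi>)
        + fps_const (G * y 1 * d x * \<delta>') * \<psi> ^ (n - 1)"
      by (simp add: algebra_simps flip: fps_const_mult)
    also have "\<dots> \<approx>\<^bsub>n\<^esub> fps_const (G * y 0) * \<psi> * u
        + fps_const (G * y 1) * u * (fps_const D * \<Phi> + fps_const (D * Q * \<delta> / G) * fps_X ^ (n - 1))
        + fps_const (G * y 1 * d x * \<delta>') * (fps_const (A ^ (n - 1)) * fps_X ^ (n - 1))"
      by (intro cong_upto_add cong_upto_mult_left cong_upto_refl comp \<psi>n)
    also have "\<dots> = fps_const (G * y 0) * \<psi> * u + fps_const (G * y 1 * D) * u * \<Phi>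
        + fps_const (y 1 * D * Q * \<delta>) * (u * fps_X ^ (n - 1))
        + fps_const (y 1 * d x * (G * \<delta>' * A ^ (n - 1))) * fps_X ^ (n - 1)"
    proof -
      define q where "q = D * Q * \<delta> / G"
      have q: "y 1 * D * Q * \<delta> = G * y 1 * q" using G by (simp add: q_def)
      show ?thesis
        unfolding q_def[symmetric] q by (simp add: algebra_simps flip: fps_const_mult)
    qed
    also have "\<dots> \<approx>\<^bsub>n\<^esub> fps_const (G * y 0) * \<psi> * u + fps_const (G * y 1 * D) * u * \<Phi>
        + fps_const (y 1 * D * Q * \<delta>) * (fps_const (h x $ 0) * fps_X ^ (n - 1))
        + fps_const (y 1 * d x * (G * \<delta>' * A ^ (n - 1))) * fps_X ^ (n - 1)"
      by (intro cong_upto_add cong_upto_mult_left cong_upto_refl top)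
    also have "\<dots> = fps_const (G * y 0) * \<psi> * u + fps_const (G * y 1 * D) * u * \<Phi>
        + fps_const (y 1 * D * \<delta> * \<kappa> x) * fps_X ^ (n - 1)"
      unfolding \<delta>' \<kappa>_def by (simp add: algebra_simps flip: fps_const_mult fps_const_add)
    finally have lhs: "h (f (brk L' x y)) \<approx>\<^bsub>n\<^esub> \<dots>" .
    \<comment> \<open>On the target side the two multiples of \<open>B\<close> cancel and \<open>\<Phi> X\<^sup>n\<^sup>-\<^sup>2\<close> drops out.\<close>
    have XX: "fps_X ^ (n - 1) = fps_X * (fps_X ^ (n - 2) :: complex fps)"
    proof -
      have "n - 1 = Suc (n - 2)" using n_ge_4 by simp
      then show ?thesis by simp
    qed
    have \<Phi>X: "\<Phi> * fps_X ^ (n - 2) \<approx>\<^bsub>n\<^esub> 0"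
    proof -
      have "(\<Phi> * fps_X ^ (n - 2)) $ m = 0" if "m < n" for m
      proof (cases "m < n - 2")
        case False
        then have "m - (n - 2) = 0 \<or> m - (n - 2) = 1" using that by auto
        then show ?thesis using \<Phi> by (auto simp: fps_X_power_mult_right_nth)
      qed (simp add: fps_X_power_mult_right_nth)
      then show ?thesis by (simp add: cong_upto_iff_nth)
    qed
    let ?l = "fps_const (A * y 0) * fps_X + fps_const (B * y 0 + D * y 1) * \<Phi>"
    have "h (brk L (f x) (f y)) \<approx>\<^bsub>n\<^esub> ?l * h (f x)
        + fps_const ((B * y 0 + D * y 1) * \<kappa> x * \<delta>) * fps_X ^ (n - 1)"
      using b(3) unfolding d_f f_0 f_1 .
    also have "\<dots> \<approx>\<^bsub>n\<^esub> ?l * F x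
        + fps_const ((B * y 0 + D * y 1) * \<kappa> x * \<delta>) * fps_X ^ (n - 1)"
      by (intro cong_upto_add cong_upto_mult_left cong_upto_refl h_f)
    also have "\<dots> = fps_const (G * y 0) * \<psi> * u + fps_const (G * y 1 * D) * u * \<Phi>
        + fps_const (y 1 * D * \<delta> * \<kappa> x) * fps_X ^ (n - 1)
        - fps_const ((B * y 0 + D * y 1) * (K * \<kappa> x)) * (\<Phi> * fps_X ^ (n - 2))"
    proof -
      have c: "fps_const (A * y 0) * fps_const (K * \<kappa> x) = fps_const (B * y 0 * \<kappa> x * \<delta>)"
        using A by (simp add: K_def mult_ac)
      have "fps_const (A * y 0) * fps_X * (fps_const (K * \<kappa> x) * fps_X ^ (n - 2))
          = (fps_const (A * y 0) * fps_const (K * \<kappa> x)) * (fps_X * fps_X ^ (n - 2))"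
        by (simp only: mult_ac)
      also have "\<dots> = fps_const (B * y 0 * \<kappa> x * \<delta>) * fps_X ^ (n - 1)"
        unfolding c XX ..
      finally have top: "fps_const (A * y 0) * fps_X * (fps_const (K * \<kappa> x) * fps_X ^ (n - 2)) = \<dots>" .
      have "?l * F x = fps_const (G * (A * y 0)) * fps_X * u
          + fps_const (G * (B * y 0 + D * y 1)) * \<Phi> * u
          - fps_const (A * y 0) * fps_X * (fps_const (K * \<kappa> x) * fps_X ^ (n - 2))
          - fps_const ((B * y 0 + D * y 1) * (K * \<kappa> x)) * (\<Phi> * fps_X ^ (n - 2))"
        unfolding F_def u_def[symmetric]
        by (simp add: algebra_simps flip: fps_const_mult fps_const_add)
      then show ?thesis
        unfolding top \<psi>_def
        by (simp add: algebra_simps flip: fps_const_mult fps_const_add)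
    qed
    also have "\<dots> \<approx>\<^bsub>n\<^esub> fps_const (G * y 0) * \<psi> * u + fps_const (G * y 1 * D) * u * \<Phi>
        + fps_const (y 1 * D * \<delta> * \<kappa> x) * fps_X ^ (n - 1)
        - fps_const ((B * y 0 + D * y 1) * (K * \<kappa> x)) * 0"
      by (intro cong_upto_diff cong_upto_mult_left cong_upto_refl \<Phi>X)
    finally have rhs: "h (brk L (f x) (f y)) \<approx>\<^bsub>n\<^esub> fps_const (G * y 0) * \<psi> * u
        + fps_const (G * y 1 * D) * u * \<Phi> + fps_const (y 1 * D * \<delta> * \<kappa> x) * fps_X ^ (n - 1)"
      by simp
    show "h (f (brk L' x y)) \<approx>\<^bsub>n\<^esub> h (brk L (f x) (f y))"
      using cong_upto_trans[OF lhs cong_upto_sym[OF rhs]] .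
  qed
  define \<iota> where "\<iota> = fps_inv \<psi>"
  have \<iota>0: "\<iota> $ 0 = 0" by (simp add: \<iota>_def fps_inv_def)
  have \<psi>\<iota>: "\<psi> oo \<iota> = fps_X" and \<iota>\<psi>: "\<iota> oo \<psi> = fps_X"
    using \<psi>0 \<psi>1 A by (simp_all add: \<iota>_def fps_inv fps_inv_right)
  have "bij_betw f ?S ?S"
    unfolding bij_betw_def
  proof
    show "inj_on f ?S"
    proof (rule inj_onI)
      fix v w assume vw: "v \<in> ?S" "w \<in> ?S" and eq: "f v = f w"
      have \<kappa>: "\<kappa> v = \<kappa> w" using eq d_f by metis
      have "F v \<approx>\<^bsub>n\<^esub> F w" using h_f eq by (metis cong_upto_sym cong_upto_trans)
      then have "h v oo \<psi> \<approx>\<^bsub>n\<^esub> h w oo \<psi>"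
        using G by (simp add: F_def \<kappa> cong_upto_iff_nth)
      then have "(h v oo \<psi>) oo \<iota> \<approx>\<^bsub>n\<^esub> (h w oo \<psi>) oo \<iota>"
        by (rule cong_upto_compose[OF \<iota>0])
      then have h: "h v \<approx>\<^bsub>n\<^esub> h w"
        by (simp add: fps_compose_assoc[OF \<iota>0 \<psi>0, symmetric] \<psi>\<iota>)
      then have "h v $ 0 = h w $ 0" using n_ge_4 by (simp add: cong_upto_iff_nth)
      then have "d v = d w" using \<kappa> P by (simp add: \<kappa>_def)
      then show "v = w" using vw h by (intro coords_eqI)
    qed
    show "f ` ?S = ?S"
    proof
      show "?S \<subseteq> f ` ?S"
      proof
        fix w assume w: "w \<in> ?S"
        \<comment> \<open>Undo the correction term, then the substitution.\<close>
        define p where "p = fps_const (1 / G) * (h w + fps_const (K * d w) * fps_X ^ (n - 2))"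
        define v where "v = vec ((d w - Q * p $ 0) / P) (p oo \<iota>)"
        have hv: "h v \<approx>\<^bsub>n\<^esub> p oo \<iota>" by (simp add: v_def h_vec)
        have hv0: "h v $ 0 = p $ 0" using n_ge_4 by (simp add: v_def h_nth_vec)
        have \<kappa>: "\<kappa> v = d w" using P by (simp add: \<kappa>_def v_def d_vec hv0[unfolded v_def])
        have "h v oo \<psi> \<approx>\<^bsub>n\<^esub> (p oo \<iota>) oo \<psi>" by (rule cong_upto_compose[OF \<psi>0 hv])
        also have "(p oo \<iota>) oo \<psi> = p"
          by (simp add: fps_compose_assoc[OF \<psi>0 \<iota>0, symmetric] \<iota>\<psi>)
        finally have "F v \<approx>\<^bsub>n\<^esub> h w"
          using G by (simp add: F_def \<kappa> p_def cong_upto_iff_nth)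
        then have "h (f v) \<approx>\<^bsub>n\<^esub> h w" using h_f cong_upto_trans by blast
        then have "f v = w" using w by (intro coords_eqI f_in) (simp_all add: d_f \<kappa>)
        then show "w \<in> f ` ?S" by (metis imageI v_def vec_in)
      qed
    qed (auto simp: f_in)
  qed
  then show ?thesis
    unfolding alg_isomorphic_def
    using L L' f_add f_scale f_brk by (intro exI[of _ f]) (simp add: presents_def)
qed

text \<open>Everything is read off from the images of four products: \<open>X\<^sup>t g\<close> is an iterated product of \<open>g\<close>
  with \<open>e\<^sub>0\<close>, which gives \<open>A, G \<noteq> 0\<close> because \<open>X\<^sup>n\<^sup>-\<^sup>1 g\<close> is not killed; \<open>[g, e\<^sub>1] = \<Phi>' g\<close> gives
  \<open>C = 0\<close> and the composition equation; \<open>[u, e\<^sub>0] = 0\<close> shows that the module component of \<open>f u\<close> has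
  order at least \<open>n - 2\<close>; and \<open>[u, e\<^sub>1] = \<delta>' X\<^sup>n\<^sup>-\<^sup>1 g\<close> gives the relation between \<open>\<delta>'\<close> and \<open>\<delta>\<close>.\<close>
lemma isomorphic_imp_iso_data:
  assumes L': "presents L' \<Phi>' \<delta>'" and L: "presents L \<Phi> \<delta>"
    and \<Phi>': "\<Phi>' $ 0 = 0" "\<Phi>' $ 1 = 0" and \<Phi>: "\<Phi> $ 0 = 0" "\<Phi> $ 1 = 0"
    and iso: "L' \<simeq> L"
  shows "\<exists>A B D P Q G. iso_data \<Phi>' \<delta>' \<Phi> \<delta> A B D P Q G"
proof -
  let ?S = "coord_space n"
  obtain f where bij: "bij_betw f ?S ?S"
    and f_add: "\<And>x y. x \<in> ?S \<Longrightarrow> y \<in> ?S \<Longrightarrow> f (x + y) = f x + f y"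
    and f_scale: "\<And>c x. x \<in> ?S \<Longrightarrow> f (c *\<^sub>c x) = c *\<^sub>c f x"
    and f_brk: "\<And>x y. x \<in> ?S \<Longrightarrow> y \<in> ?S \<Longrightarrow> f (brk L' x y) = brk L (f x) (f y)"
    using iso L L' unfolding alg_isomorphic_def presents_def by auto
  have f_in: "f x \<in> ?S" if "x \<in> ?S" for x
    using bij that by (auto simp: bij_betw_def)
  have inj: "x = y" if "f x = f y" "x \<in> ?S" "y \<in> ?S" for x y
    using bij that by (auto simp: bij_betw_def inj_on_def)
  have f_zero: "f 0 = 0"
    using f_scale[OF zero_in, of 0] by (simp add: cscale_def zero_fun_def)
  have e_in: "e 0 \<in> ?S" "e 1 \<in> ?S"
    using n_ge_4 by (auto simp: e_def coord_space_def)
  have n3: "0 < n - 2" "n - 1 = Suc (n - 2)" "n = Suc (n - 1)" using n_ge_4 by auto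
  define A B C D where "A = f (e 0) 0" and "B = f (e 0) 1" and "C = f (e 1) 0" and "D = f (e 1) 1"
  define \<psi> \<chi> where "\<psi> = fps_const A * fps_X + fps_const B * \<Phi>"
    and "\<chi> = fps_const C * fps_X + fps_const D * \<Phi>"
  have \<psi>0: "\<psi> $ 0 = 0" and \<psi>1: "\<psi> $ 1 = A"
    using \<Phi> by (simp_all add: \<psi>_def)
  have R0: "d (f (brk L' x (e 0))) = 0"
      "h (f (brk L' x (e 0))) \<approx>\<^bsub>n\<^esub> \<psi> * h (f x) + fps_const (B * d (f x) * \<delta>) * fps_X ^ (n - 1)"
    and R1: "d (f (brk L' x (e 1))) = 0"
      "h (f (brk L' x (e 1))) \<approx>\<^bsub>n\<^esub> \<chi> * h (f x) + fps_const (D * d (f x) * \<delta>) * fps_X ^ (n - 1)"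
    if "x \<in> ?S" for x
    using presentsD[OF L f_in[OF that] f_in[OF e_in(1)]] presentsD[OF L f_in[OF that] f_in[OF e_in(2)]]
    by (simp_all add: f_brk that e_in A_def B_def C_def D_def \<psi>_def \<chi>_def del: One_nat_def)
  define m where "m t = vec 0 (fps_X ^ t)" for t
  have m_in: "m t \<in> ?S" and d_m: "d (m t) = 0" and h_m: "h (m t) \<approx>\<^bsub>n\<^esub> fps_X ^ t" for t
    by (simp_all add: m_def vec_in d_vec h_vec)
  have R0': "d (brk L' x (e 0)) = 0" "brk L' x (e 0) \<in> ?S"
      "h (brk L' x (e 0)) \<approx>\<^bsub>n\<^esub> fps_X * h x"
    and R1': "d (brk L' x (e 1)) = 0" "brk L' x (e 1) \<in> ?S"
      "h (brk L' x (e 1)) \<approx>\<^bsub>n\<^esub> \<Phi>' * h x + fps_const (d x * \<delta>') * fps_X ^ (n - 1)"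
    if "x \<in> ?S" for x
    using presentsD[OF L' that e_in(1)] presentsD[OF L' that e_in(2)]
    by (simp_all add: e_def)
  have m_Suc: "brk L' (m t) (e 0) = m (Suc t)" for t
  proof (rule coords_eqI)
    have "h (brk L' (m t) (e 0)) \<approx>\<^bsub>n\<^esub> fps_X * h (m t)" by (rule R0'[OF m_in])
    also have "\<dots> \<approx>\<^bsub>n\<^esub> fps_X * fps_X ^ t" by (intro cong_upto_mult_left h_m)
    also have "\<dots> = fps_X ^ Suc t" by simp
    also have "\<dots> \<approx>\<^bsub>n\<^esub> h (m (Suc t))" by (rule cong_upto_sym[OF h_m])
    finally show "h (brk L' (m t) (e 0)) \<approx>\<^bsub>n\<^esub> h (m (Suc t))" .
  qed (simp_all add: R0' m_in d_m)
  \<comment> \<open>The module components of \<open>f g\<close> and \<open>f u\<close>.\<close>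
  define r w where "r = h (f (m 0))" and "w = h (f (vec 1 0))"
  define P Q G where "P = d (f (vec 1 0))" and "Q = d (f (m 0))" and "G = r $ 0"
  \<comment> \<open>The \<open>u\<close>-component \<open>Q\<close> of \<open>f g\<close> contributes only to the first product with \<open>f e\<^sub>0\<close>: its
      contribution lies in degree \<open>n - 1\<close>, which \<open>\<psi>\<close> annihilates.\<close>
  have h_f_m: "d (f (m (Suc t))) = 0 \<and> h (f (m (Suc t))) \<approx>\<^bsub>n\<^esub> \<psi> ^ Suc t * r
      + (if t = 0 then fps_const (B * Q * \<delta>) * fps_X ^ (n - 1) else 0)" for t
  proof (induction t)
    case 0
    show ?case using R0[OF m_in[of 0]] unfolding m_Suc by (simp add: r_def Q_def)
  next
    case (Suc t)
    let ?c = "if t = 0 then fps_const (B * Q * \<delta>) * fps_X ^ (n - 1) else 0"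
    have "h (f (m (Suc (Suc t)))) \<approx>\<^bsub>n\<^esub> \<psi> * h (f (m (Suc t)))"
      using R0(2)[OF m_in[of "Suc t"]] Suc.IH unfolding m_Suc by simp
    also have "\<dots> \<approx>\<^bsub>n\<^esub> \<psi> * (\<psi> ^ Suc t * r + ?c)"
      using Suc.IH by (intro cong_upto_mult_left) simp
    also have "\<dots> = \<psi> ^ Suc (Suc t) * r
        + fps_const (if t = 0 then B * Q * \<delta> else 0) * (fps_X ^ (n - 1) * \<psi>)"
      by (simp add: algebra_simps)
    also have "\<dots> \<approx>\<^bsub>n\<^esub> \<psi> ^ Suc (Suc t) * r
        + fps_const (if t = 0 then B * Q * \<delta> else 0) * (fps_const (\<psi> $ 0) * fps_X ^ (n - 1))"
      using n_ge_4 by (intro cong_upto_add cong_upto_mult_left cong_upto_refl cong_upto_top_mult) simp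
    finally show ?case
      using R0(1)[OF m_in[of "Suc t"]] unfolding m_Suc by (simp add: \<psi>0)
  qed
  have h_f_m2: "h (f (m t)) \<approx>\<^bsub>n\<^esub> \<psi> ^ t * r" if "2 \<le> t" for t
    using h_f_m[of "t - 1"] that by simp
  let ?last = "m (n - 1)"
  have last: "d (f ?last) = 0" "h (f ?last) \<approx>\<^bsub>n\<^esub> fps_const (A ^ (n - 1) * G) * fps_X ^ (n - 1)"
  proof -
    show "d (f ?last) = 0" using h_f_m[of "n - 2"] n3 by simp
    have "h (f ?last) \<approx>\<^bsub>n\<^esub> \<psi> ^ (n - 1) * r" using n_ge_4 by (intro h_f_m2) simp
    also have "\<dots> \<approx>\<^bsub>n\<^esub> fps_const (A ^ (n - 1) * G) * fps_X ^ (n - 1)"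
    proof -
      have "(\<psi> ^ (n - 1) * r) $ i = (if i = n - 1 then A ^ (n - 1) * G else 0)" if "i < n" for i
      proof (cases "i = n - 1")
        case True
        then show ?thesis using power_order_one_mult_nth[OF \<psi>0, of "n - 1" r] \<psi>1
          by (simp add: G_def)
      next
        case False
        then have "i < n - 1" using that by simp
        moreover have "fps_X ^ (n - 1) dvd \<psi> ^ (n - 1) * r"
          using power_order_one_dvd[OF \<psi>0] by (rule dvd_mult2)
        ultimately show ?thesis using False by (simp add: fps_X_power_dvd_iff)
      qed
      then show ?thesis by (simp add: cong_upto_iff_nth fps_X_power_nth)
    qed
    finally show "h (f ?last) \<approx>\<^bsub>n\<^esub> fps_const (A ^ (n - 1) * G) * fps_X ^ (n - 1)" .
  qed
  have AG: "A \<noteq> 0" "G \<noteq> 0"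
  proof -
    have "A ^ (n - 1) * G \<noteq> 0"
    proof
      assume zero: "A ^ (n - 1) * G = 0"
      have "h (f ?last) \<approx>\<^bsub>n\<^esub> 0" using last(2) unfolding zero by simp
      then have "f ?last = f 0"
        using last(1) by (intro coords_eqI f_in m_in zero_in) (simp_all add: f_zero d_zero h_zero)
      then have "?last = 0" by (rule inj) (simp_all add: m_in zero_in)
      then have "h ?last $ (n - 1) = 0" by (simp add: h_zero)
      then show False using h_m[of "n - 1"] n3 by (auto simp: cong_upto_iff_nth)
    qed
    then show "A \<noteq> 0" "G \<noteq> 0" using n3 by auto
  qed

  have compose: "\<chi> * r + fps_const (D * Q * \<delta>) * fps_X ^ (n - 1) \<approx>\<^bsub>n\<^esub> (\<Phi>' oo \<psi>) * r"
  proof -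
    define s where "s N = (\<Sum>t<N. (\<Phi>' $ t) *\<^sub>c m t)" for N :: nat
    have s: "s N \<in> ?S \<and> d (s N) = 0 \<and> h (s N) = (\<Sum>t<N. fps_const (\<Phi>' $ t) * h (m t))
        \<and> h (f (s N)) = (\<Sum>t<N. fps_const (\<Phi>' $ t) * h (f (m t)))" for N
    proof (induction N)
      case 0
      have "s 0 = 0" by (simp add: s_def)
      then show ?case by (simp add: zero_in d_zero h_zero f_zero del: zero_fun_apply)
    next
      case (Suc N)
      have s_Suc: "s (Suc N) = s N + (\<Phi>' $ N) *\<^sub>c m N" unfolding s_def by (rule sum.lessThan_Suc)
      show ?case
        unfolding s_Suc
        using Suc by (simp add: add_in scale_in m_in d_add d_scale d_m h_add h_scale f_add f_scale
            del: plus_fun_apply)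
    qed
    have "brk L' (m 0) (e 1) = s n"
    proof (rule coords_eqI)
      have "h (brk L' (m 0) (e 1)) \<approx>\<^bsub>n\<^esub> \<Phi>' * h (m 0)" using R1'(3)[OF m_in] by (simp add: d_m)
      also have "\<dots> \<approx>\<^bsub>n\<^esub> \<Phi>' * fps_X ^ 0" by (intro cong_upto_mult_left h_m)
      also have "\<dots> = \<Phi>' oo fps_X" by simp
      also have "\<dots> \<approx>\<^bsub>n\<^esub> (\<Sum>t<n. fps_const (\<Phi>' $ t) * fps_X ^ t)"
        by (rule compose_cong_upto_sum) simp
      also have "\<dots> \<approx>\<^bsub>n\<^esub> (\<Sum>t<n. fps_const (\<Phi>' $ t) * h (m t))"
        by (intro cong_upto_sum cong_upto_mult_left cong_upto_sym[OF h_m])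
      finally show "h (brk L' (m 0) (e 1)) \<approx>\<^bsub>n\<^esub> h (s n)" using s by simp
    qed (use s R1'[OF m_in] in auto)
    then have "\<chi> * r + fps_const (D * Q * \<delta>) * fps_X ^ (n - 1) \<approx>\<^bsub>n\<^esub> h (f (s n))"
      using cong_upto_sym[OF R1(2)[OF m_in[of 0]]] by (simp add: r_def Q_def)
    also have "h (f (s n)) = (\<Sum>t<n. fps_const (\<Phi>' $ t) * h (f (m t)))" using s by blast
    also have "\<dots> \<approx>\<^bsub>n\<^esub> (\<Sum>t<n. fps_const (\<Phi>' $ t) * (\<psi> ^ t * r))"
    proof (rule cong_upto_sum)
      fix t :: nat
      consider "t = 0" | "t = 1" | "2 \<le> t" by linarith
      then show "fps_const (\<Phi>' $ t) * h (f (m t)) \<approx>\<^bsub>n\<^esub> fps_const (\<Phi>' $ t) * (\<psi> ^ t * r)"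
        by cases (use \<Phi>' in \<open>auto intro: cong_upto_mult_left h_f_m2\<close>)
    qed
    also have "\<dots> = r * (\<Sum>t<n. fps_const (\<Phi>' $ t) * \<psi> ^ t)"
      by (simp add: sum_distrib_left mult_ac)
    also have "\<dots> \<approx>\<^bsub>n\<^esub> r * (\<Phi>' oo \<psi>)"
      by (intro cong_upto_mult_left cong_upto_sym[OF compose_cong_upto_sum] \<psi>0)
    finally show ?thesis by (simp add: mult.commute)
  qed
  \<comment> \<open>In degree 1 only \<open>C X\<close> contributes to the equation \<open>compose\<close>: all other terms have order at
      least 2.\<close>
  have C: "C = 0"
  proof -
    have "(\<chi> * r + fps_const (D * Q * \<delta>) * fps_X ^ (n - 1)) $ 1 = ((\<Phi>' oo \<psi>) * r) $ 1"
      using compose[unfolded cong_upto_iff_nth, rule_format, of 1] n_ge_4 by linarith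
    moreover have "(\<Phi>' oo \<psi>) $ 0 = 0" "(\<Phi>' oo \<psi>) $ 1 = 0"
      using \<Phi>' by (simp_all add: fps_compose_nth)
    moreover have "1 \<noteq> n - 1" using n_ge_4 by simp
    ultimately have "C * G = 0"
      using \<Phi> by (simp add: \<chi>_def fps_X_power_nth G_def)
    then show ?thesis using AG by simp
  qed
  have comp: "\<Phi>' oo \<psi> \<approx>\<^bsub>n\<^esub> fps_const D * \<Phi> + fps_const (D * Q * \<delta> / G) * fps_X ^ (n - 1)"
  proof (rule cong_upto_cancel_unit)
    show "r $ 0 \<noteq> 0" using AG by (simp add: G_def)
    have "(\<Phi>' oo \<psi>) * r \<approx>\<^bsub>n\<^esub> \<chi> * r + fps_const (D * Q * \<delta>) * fps_X ^ (n - 1)"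
      by (rule cong_upto_sym[OF compose])
    also have "\<dots> = \<chi> * r + fps_const (D * Q * \<delta> / G) * (fps_const (r $ 0) * fps_X ^ (n - 1))"
      using AG by (simp add: G_def flip: mult.assoc)
    also have "\<dots> \<approx>\<^bsub>n\<^esub> \<chi> * r + fps_const (D * Q * \<delta> / G) * (fps_X ^ (n - 1) * r)"
      using n_ge_4
      by (intro cong_upto_add cong_upto_mult_left cong_upto_refl cong_upto_sym[OF cong_upto_top_mult]) simp
    finally show "(\<Phi>' oo \<psi>) * r
        \<approx>\<^bsub>n\<^esub> (fps_const D * \<Phi> + fps_const (D * Q * \<delta> / G) * fps_X ^ (n - 1)) * r"
      by (simp add: \<chi>_def C algebra_simps)
  qed

  have w_eq: "\<psi> * w + fps_const (B * P * \<delta>) * fps_X ^ (n - 1) \<approx>\<^bsub>n\<^esub> 0"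
  proof -
    have "brk L' (vec 1 0) (e 0) = 0"
    proof (rule coords_eqI)
      have "h (brk L' (vec 1 0) (e 0)) \<approx>\<^bsub>n\<^esub> fps_X * h (vec 1 0)" by (intro R0' vec_in)
      also have "\<dots> \<approx>\<^bsub>n\<^esub> fps_X * 0" by (intro cong_upto_mult_left h_vec)
      finally show "h (brk L' (vec 1 0) (e 0)) \<approx>\<^bsub>n\<^esub> h 0" by (simp add: h_zero)
    qed (simp_all add: R0' vec_in zero_in d_zero)
    then show ?thesis
      using cong_upto_sym[OF R0(2)[OF vec_in[of 1 0]]] by (simp add: f_zero h_zero w_def P_def)
  qed
  have w_dvd: "fps_X ^ (n - 2) dvd w"
  proof (rule dvd_order_one_cancel[OF \<psi>0])
    have "(\<psi> * w) $ i = 0" if "i < n - 1" for i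
      using w_eq[unfolded cong_upto_iff_nth, rule_format, of i] that by (simp add: fps_X_power_nth)
    then show "fps_X ^ Suc (n - 2) dvd \<psi> * w"
      unfolding fps_X_power_dvd_iff using n3(2) by simp
  qed (use \<psi>1 AG in simp)
  have w0: "w $ 0 = 0" using w_dvd n3 by (simp add: fps_X_power_dvd_iff)
  have \<delta>': "G * \<delta>' * A ^ (n - 1) = D * P * \<delta>"
  proof -
    have "brk L' (vec 1 0) (e 1) = \<delta>' *\<^sub>c ?last"
    proof (rule coords_eqI)
      have "h (brk L' (vec 1 0) (e 1)) \<approx>\<^bsub>n\<^esub> \<Phi>' * h (vec 1 0) + fps_const (1 * \<delta>') * fps_X ^ (n - 1)"
        using R1'(3)[OF vec_in[of 1 0]] by (simp add: d_vec)
      also have "\<dots> \<approx>\<^bsub>n\<^esub> \<Phi>' * 0 + fps_const (1 * \<delta>') * h ?last"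
        by (intro cong_upto_add cong_upto_mult_left h_vec cong_upto_sym[OF h_m])
      finally show "h (brk L' (vec 1 0) (e 1)) \<approx>\<^bsub>n\<^esub> h (\<delta>' *\<^sub>c ?last)" by (simp add: h_scale)
    qed (simp_all add: R1' vec_in scale_in m_in d_scale d_m del: One_nat_def)
    then have "h (f (brk L' (vec 1 0) (e 1))) = fps_const \<delta>' * h (f ?last)"
      by (simp add: f_scale m_in h_scale)
    moreover have "h (f (brk L' (vec 1 0) (e 1))) $ (n - 1)
        = (fps_const D * (\<Phi> * w) + fps_const (D * P * \<delta>) * fps_X ^ (n - 1)) $ (n - 1)"
      using R1(2)[OF vec_in[of 1 0]] n3
      by (simp add: cong_upto_iff_nth w_def P_def \<chi>_def C mult.assoc)
    moreover have "h (f ?last) $ (n - 1) = A ^ (n - 1) * G"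
      using last(2) n3 by (simp add: cong_upto_iff_nth fps_X_power_nth)
    moreover have "(\<Phi> * w) $ (n - 1) = 0"
    proof -
      have "fps_X ^ 2 dvd \<Phi>" using \<Phi> by (auto simp: fps_X_power_dvd_iff less_2_cases_iff)
      then have "fps_X ^ 2 * fps_X ^ (n - 2) dvd \<Phi> * w" using w_dvd by (rule mult_dvd_mono)
      moreover have "fps_X ^ 2 * fps_X ^ (n - 2) = (fps_X ^ n :: complex fps)"
        using n_ge_4 by (intro trans[OF power_add[symmetric]] arg_cong[of _ _ "power fps_X"]) simp
      ultimately have "fps_X ^ n dvd \<Phi> * w" by metis
      then show ?thesis using n3 by (simp add: fps_X_power_dvd_iff)
    qed
    ultimately have "\<delta>' * (A ^ (n - 1) * G) = D * P * \<delta>" by (simp add: fps_X_power_nth)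
    then show ?thesis by (simp only: mult_ac)
  qed
  \<comment> \<open>If \<open>P\<close> were zero, \<open>f u\<close> would be a multiple of \<open>X\<^sup>n\<^sup>-\<^sup>1\<close>, hence proportional to the image of
      \<open>X\<^sup>n\<^sup>-\<^sup>1 g\<close>, against injectivity.\<close>
  have P: "P \<noteq> 0"
  proof
    assume P: "P = 0"
    have "fps_X ^ Suc (n - 1) dvd \<psi> * w"
      using w_eq n3 by (simp add: P cong_upto_def)
    then have "fps_X ^ (n - 1) dvd w"
      by (rule dvd_order_one_cancel[OF \<psi>0, rotated]) (use \<psi>1 AG in simp)
    then have w: "w \<approx>\<^bsub>n\<^esub> fps_const (w $ (n - 1)) * fps_X ^ (n - 1)"
      by (auto simp: fps_X_power_dvd_iff cong_upto_iff_nth fps_X_power_nth)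
    let ?c = "A ^ (n - 1) * G"
    have "f (?c *\<^sub>c vec 1 0) = f ((w $ (n - 1)) *\<^sub>c ?last)"
    proof (rule coords_eqI)
      have "h (f (?c *\<^sub>c vec 1 0)) = fps_const ?c * w"
        by (simp add: f_scale vec_in h_scale w_def)
      also have "\<dots> \<approx>\<^bsub>n\<^esub> fps_const ?c * (fps_const (w $ (n - 1)) * fps_X ^ (n - 1))"
        by (rule cong_upto_mult_left[OF w])
      also have "\<dots> = fps_const (w $ (n - 1)) * (fps_const ?c * fps_X ^ (n - 1))"
        by (rule mult.left_commute)
      also have "\<dots> \<approx>\<^bsub>n\<^esub> fps_const (w $ (n - 1)) * h (f ?last)"
        by (rule cong_upto_mult_left[OF cong_upto_sym[OF last(2)]])
      finally show "h (f (?c *\<^sub>c vec 1 0)) \<approx>\<^bsub>n\<^esub> h (f ((w $ (n - 1)) *\<^sub>c ?last))"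
        by (simp add: f_scale m_in h_scale)
    qed (simp_all add: f_in scale_in vec_in m_in f_scale d_scale last P[unfolded P_def] del: One_nat_def)
    then have "?c *\<^sub>c vec 1 0 = (w $ (n - 1)) *\<^sub>c ?last"
      by (rule inj) (simp_all add: scale_in vec_in m_in)
    then have "d (?c *\<^sub>c vec 1 0) = d ((w $ (n - 1)) *\<^sub>c ?last)" by simp
    then show False using AG by (simp add: d_scale d_vec d_m)
  qed

  \<comment> \<open>Compute \<open>f (a u + b g)\<close> once from \<open>f u\<close> and \<open>f g\<close> and once from \<open>f e\<^sub>0\<close> and \<open>f e\<^sub>1\<close>.\<close>
  have "l0 (P * a + Q * b) (G * b) = A * l0 a b \<and>
      l1 (P * a + Q * b) (G * b) = B * l0 a b + D * l1 a b" for a b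
  proof -
    let ?v = "vec a (fps_const b)"
    have "?v = a *\<^sub>c vec 1 0 + b *\<^sub>c m 0"
    proof (rule coords_eqI)
      have "h ?v \<approx>\<^bsub>n\<^esub> fps_const a * 0 + fps_const b * fps_X ^ 0" using h_vec by simp
      also have "\<dots> \<approx>\<^bsub>n\<^esub> fps_const a * h (vec 1 0) + fps_const b * h (m 0)"
        by (intro cong_upto_add cong_upto_mult_left cong_upto_sym[OF h_m] cong_upto_sym[OF h_vec])
      finally show "h ?v \<approx>\<^bsub>n\<^esub> h (a *\<^sub>c vec 1 0 + b *\<^sub>c m 0)" by (simp add: h_add h_scale)
    qed (simp_all add: vec_in add_in scale_in m_in d_add d_scale d_vec d_m)
    then have fv: "f ?v = a *\<^sub>c f (vec 1 0) + b *\<^sub>c f (m 0)"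
      by (simp add: f_add f_scale scale_in vec_in m_in)
    have d: "d (f ?v) = P * a + Q * b"
      unfolding fv by (simp add: d_add d_scale P_def Q_def mult.commute)
    have h: "h (f ?v) $ 0 = G * b"
      unfolding fv using w0 by (simp add: h_add h_scale G_def r_def w_def mult.commute)
    have fv': "f ?v = l0 a b *\<^sub>c f (e 0) + l1 a b *\<^sub>c f (e 1)"
      unfolding vec_const using e_in by (simp add: f_add f_scale scale_in)
    show ?thesis
      using coord_0[of "f ?v"] coord_1[of "f ?v"] unfolding d h
      unfolding fv' using C by (simp add: cscale_def A_def B_def C_def D_def mult.commute)
  qed
  then have "iso_data \<Phi>' \<delta>' \<Phi> \<delta> A B D P Q G"
    using AG P comp \<delta>' by (simp add: iso_data_def \<psi>_def)
  then show ?thesis by blast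
qed

theorem isomorphic_iff_iso_data:
  assumes L: "presents L \<Phi> \<delta>" and M: "presents M \<Phi>' \<delta>'"
    and "\<Phi> $ 0 = 0" "\<Phi> $ 1 = 0" "\<Phi>' $ 0 = 0" "\<Phi>' $ 1 = 0"
  shows "L \<simeq> M \<longleftrightarrow> (\<exists>A B D P Q G. iso_data \<Phi>' \<delta>' \<Phi> \<delta> A B D P Q G)"
proof
  assume "L \<simeq> M"
  then have "M \<simeq> L"
    by (rule alg_isomorphic_sym) (use L in \<open>auto simp: presents_def add_in scale_in\<close>)
  then show "\<exists>A B D P Q G. iso_data \<Phi>' \<delta>' \<Phi> \<delta> A B D P Q G"
    by (rule isomorphic_imp_iso_data[OF M L assms(5,6,3,4)])
next
  assume "\<exists>A B D P Q G. iso_data \<Phi>' \<delta>' \<Phi> \<delta> A B D P Q G"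
  then have "M \<simeq> L" using iso_data_imp_isomorphic[OF M L] assms by blast
  then show "L \<simeq> M"
    by (rule alg_isomorphic_sym) (use M in \<open>auto simp: presents_def add_in scale_in\<close>)
qed

end

section \<open>The two families\<close>

text \<open>The module component of \<open>v\<close>. The coefficient of the generator depends on the family and is
  therefore an argument; the coordinates from 2 on are shared.\<close>
definition coord_series :: "complex \<Rightarrow> (nat \<Rightarrow> complex) \<Rightarrow> complex fps"
  where "coord_series c v = Abs_fps (\<lambda>m. if m = 0 then c else v (m + 1))"

lemma coord_series_nth: "coord_series c v $ m = (if m = 0 then c else v (m + 1))"
  by (simp add: coord_series_def)

lemma sum_atMost_split_01:
  fixes n :: nat
  assumes "1 \<le> n"
  shows "(\<Sum>i\<le>n. g i) = g 0 + g 1 + (\<Sum>i=2..n. g i :: complex)"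
proof -
  have "{..n} = insert 0 (insert 1 {2..n})" using assms by auto
  then show ?thesis by (simp add: add.assoc)
qed

text \<open>The sum is the form in which the column of \<open>e\<^sub>1\<close> in either table acts on the coordinates from 2
  on; only the contribution of the generator is left over.\<close>
lemma param_series_mult_coord_series_nth:
  assumes "m < n"
  shows "(param_series x * coord_series c v) $ m
    = param_series x $ m * c + (\<Sum>i=2..n. v i * (if i + 2 \<le> m + 1 then x (m + 2 - i) else 0))"
proof -
  have "(param_series x * coord_series c v) $ m
      = (\<Sum>i=0..m. coord_series c v $ i * param_series x $ (m - i))"
    unfolding mult.commute[of "param_series x"] fps_mult_nth ..
  also have "\<dots> = c * param_series x $ m + (\<Sum>i=1..m. v (i + 1) * param_series x $ (m - i))"
    by (simp add: sum.atLeast_Suc_atMost coord_series_nth)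
  also have "(\<Sum>i=1..m. v (i + 1) * param_series x $ (m - i))
      = (\<Sum>i=2..m+1. v i * param_series x $ (m + 1 - i))"
    by (rule sum.reindex_bij_witness[where i = "\<lambda>i. i - 1" and j = "\<lambda>i. i + 1"]) auto
  also have "\<dots> = (\<Sum>i=2..n. v i * (if i + 2 \<le> m + 1 then x (m + 2 - i) else 0))"
    using assms by (intro sum.mono_neutral_cong_left) (auto simp: param_series_nth Suc_diff_le)
  finally show ?thesis by (simp add: mult.commute)
qed

lemma table_brk_two_columns:
  assumes "1 \<le> n" "\<And>i j. 2 \<le> j \<Longrightarrow> P i j = 0"
  shows "table_brk n P x y k = y 0 * (\<Sum>i\<le>n. x i * P i 0 k) + y 1 * (\<Sum>i\<le>n. x i * P i 1 k)"
proof -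
  have "(\<Sum>j\<le>n. x i * y j * P i j k) = y 0 * (x i * P i 0 k) + y 1 * (x i * P i 1 k)" for i
    using assms(1) by (simp add: sum_atMost_split_01 assms(2))
  then show ?thesis by (simp add: table_brk_apply sum.distrib sum_distrib_left)
qed

text \<open>Here \<open>g = e\<^sub>1\<close> and \<open>u = e\<^sub>0 - e\<^sub>1\<close>, so \<open>v\<^sub>0 e\<^sub>0 + v\<^sub>1 e\<^sub>1 = v\<^sub>0 u + (v\<^sub>0 + v\<^sub>1) g\<close>.\<close>
lemma truncated_coords_first:
  assumes "4 \<le> n"
  shows "truncated_coords n (\<lambda>v. v 0) (\<lambda>v. coord_series (v 0 + v 1) v)
    (\<lambda>c p i. if i = 0 then c else if i = 1 then p $ 0 - c else if i \<le> n then p $ (i - 1) else 0)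
    (\<lambda>a b. a) (\<lambda>a b. b - a)"
proof
  fix v w
  assume v: "v \<in> coord_space n" "w \<in> coord_space n" and 0: "v 0 = w 0"
    and h: "coord_series (v 0 + v 1) v \<approx>\<^bsub>n\<^esub> coord_series (w 0 + w 1) w"
  have "v i = w i" for i
  proof -
    consider "i = 0" | "i = 1" | "2 \<le> i" "i \<le> n" | "n < i" by linarith
    then show ?thesis
    proof cases
      case 2
      then show ?thesis using h[unfolded cong_upto_iff_nth, rule_format, of 0] 0 assms
        by (simp add: coord_series_nth)
    next
      case 3
      then show ?thesis using h[unfolded cong_upto_iff_nth, rule_format, of "i - 1"]
        by (auto simp: coord_series_nth split: if_splits)
    qed (use 0 v in \<open>auto simp: coord_space_def\<close>)
  qed
  then show "v = w" by blast
qed (use assms in \<open>auto simp: fps_eq_iff coord_series_nth cscale_def algebra_simps coord_space_def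
       cong_upto_iff_nth e_def fun_eq_iff\<close>)

text \<open>Here \<open>g = e\<^sub>0\<close> and \<open>u = e\<^sub>1\<close>.\<close>
lemma truncated_coords_second:
  assumes "4 \<le> n"
  shows "truncated_coords n (\<lambda>v. v 1) (\<lambda>v. coord_series (v 0) v)
    (\<lambda>c p i. if i = 0 then p $ 0 else if i = 1 then c else if i \<le> n then p $ (i - 1) else 0)
    (\<lambda>a b. b) (\<lambda>a b. a)"
proof
  fix v w
  assume v: "v \<in> coord_space n" "w \<in> coord_space n" and 1: "v 1 = w 1"
    and h: "coord_series (v 0) v \<approx>\<^bsub>n\<^esub> coord_series (w 0) w"
  have "v i = w i" for i
  proof -
    consider "i = 0" | "i = 1" | "2 \<le> i" "i \<le> n" | "n < i" by linarith
    then show ?thesis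
    proof cases
      case 1
      then show ?thesis using h[unfolded cong_upto_iff_nth, rule_format, of 0] assms
        by (simp add: coord_series_nth)
    next
      case 3
      then show ?thesis using h[unfolded cong_upto_iff_nth, rule_format, of "i - 1"]
        by (auto simp: coord_series_nth split: if_splits)
    qed (use \<open>v 1 = w 1\<close> v in \<open>auto simp: coord_space_def\<close>)
  qed
  then show "v = w" by blast
qed (use assms in \<open>auto simp: fps_eq_iff coord_series_nth cscale_def algebra_simps coord_space_def
       cong_upto_iff_nth e_def fun_eq_iff\<close>)

lemma first_table_column_0:
  assumes "4 \<le> n"
  shows "(\<Sum>i\<le>n. x i * first_table n \<alpha> \<theta> i 0 k)
    = (if k = 2 then x 0 + x 1 else if 3 \<le> k \<and> k \<le> n then x (k - 1) else 0)"
proof -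
  have "(\<Sum>i=2..n. x i * first_table n \<alpha> \<theta> i 0 k)
      = (\<Sum>i=2..n. if i = k - 1 then (if 3 \<le> k \<and> k \<le> n then x i else 0) else 0)"
    using assms by (intro sum.cong) (auto simp: first_table_apply[OF assms] e_def)
  also have "\<dots> = (if 3 \<le> k \<and> k \<le> n then x (k - 1) else 0)" by auto
  finally show ?thesis
    using assms by (simp add: sum_atMost_split_01 first_table_apply[OF assms, of _ _ _ 0] e_def numeral_2_eq_2)
qed

lemma second_table_column_0:
  assumes "4 \<le> n"
  shows "(\<Sum>i\<le>n. x i * second_table n \<beta> \<gamma> i 0 k)
    = (if k = 2 then x 0 else if 3 \<le> k \<and> k \<le> n then x (k - 1) else 0)"
proof -
  have "(\<Sum>i=2..n. x i * second_table n \<beta> \<gamma> i 0 k)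
      = (\<Sum>i=2..n. if i = k - 1 then (if 3 \<le> k \<and> k \<le> n then x i else 0) else 0)"
    using assms by (intro sum.cong) (auto simp: second_table_apply[OF assms] e_def)
  also have "\<dots> = (if 3 \<le> k \<and> k \<le> n then x (k - 1) else 0)" by auto
  finally show ?thesis
    using assms by (simp add: sum_atMost_split_01 second_table_apply[OF assms, of _ _ _ 0] e_def numeral_2_eq_2)
qed

text \<open>The rows of \<open>e\<^sub>0\<close> and \<open>e\<^sub>1\<close> have the same entries \<open>\<alpha>\<^sub>3, \<dots>, \<alpha>\<^sub>n\<^sub>-\<^sub>1\<close> and differ only in the last one,
  \<open>\<theta>\<close> against \<open>\<alpha>\<^sub>n\<close>. This defect is the \<open>\<delta>\<close> of the first family.\<close>
lemma first_table_column_1: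
  assumes "4 \<le> n" "m < n"
  shows "(\<Sum>i\<le>n. x i * first_table n \<alpha> \<theta> i 1 (m + 1))
    = (param_series \<alpha> * coord_series (x 0 + x 1) x) $ m
      + (if m = n - 1 then x 0 * (\<theta> - \<alpha> n) else 0)"
proof -
  have "(\<Sum>i=2..n. x i * first_table n \<alpha> \<theta> i 1 (m + 1))
      = (\<Sum>i=2..n. x i * (if i + 2 \<le> m + 1 then \<alpha> (m + 2 - i) else 0))"
    using assms by (intro sum.cong) (auto simp: first_table_e1_apply[OF assms(1)])
  then show ?thesis
    unfolding param_series_mult_coord_series_nth[OF assms(2)]
    using assms by (auto simp: sum_atMost_split_01 first_table_e1_apply[OF assms(1)]
        param_series_nth algebra_simps)
qed

lemma second_table_column_1:
  assumes "4 \<le> n" "m < n"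
  shows "(\<Sum>i\<le>n. x i * second_table n \<beta> \<gamma> i 1 (m + 1))
    = (param_series \<beta> * coord_series (x 0) x) $ m + (if m = n - 1 then x 1 * \<gamma> else 0)"
proof -
  have "(\<Sum>i=2..n. x i * second_table n \<beta> \<gamma> i 1 (m + 1))
      = (\<Sum>i=2..n. x i * (if i + 2 \<le> m + 1 then \<beta> (m + 2 - i) else 0))"
    using assms by (intro sum.cong) (auto simp: second_table_e1_apply[OF assms(1)])
  then show ?thesis
    unfolding param_series_mult_coord_series_nth[OF assms(2)]
    using assms by (auto simp: sum_atMost_split_01 second_table_e1_apply[OF assms(1)]
        param_series_nth algebra_simps)
qed

lemma presents_L_first:
  assumes n: "4 \<le> n"
  shows "truncated_coords.presents n (\<lambda>v. v 0) (\<lambda>v. coord_series (v 0 + v 1) v)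
    (L_first n \<alpha> \<theta>) (param_series \<alpha>) (\<theta> - \<alpha> n)"
proof -
  interpret truncated_coords n "\<lambda>v. v 0" "\<lambda>v. coord_series (v 0 + v 1) v"
    "\<lambda>c p i. if i = 0 then c else if i = 1 then p $ 0 - c else if i \<le> n then p $ (i - 1) else 0"
    "\<lambda>a b. a" "\<lambda>a b. b - a"
    by (rule truncated_coords_first[OF n])
  let ?L = "L_first n \<alpha> \<theta>" and ?P = "first_table n \<alpha> \<theta>"
  have carr: "carr ?L = coord_space n" by (simp add: L_first_def table_algebra_def)
  have brk: "brk ?L x y k = y 0 * (\<Sum>i\<le>n. x i * ?P i 0 k) + y 1 * (\<Sum>i\<le>n. x i * ?P i 1 k)" for x y k
    unfolding L_first_def using n by (intro table_brk_two_columns) (auto simp: first_table_def)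
  have low: "brk ?L x y 0 = 0" "brk ?L x y 1 = 0" for x y
  proof -
    have "?P i 1 0 = 0" "?P i 1 1 = 0" for i
      using n by (auto simp: first_table_e1_apply)
    then show "brk ?L x y 0 = 0" "brk ?L x y 1 = 0"
      unfolding brk first_table_column_0[OF n] by simp_all
  qed
  have closed: "brk ?L x y \<in> carr ?L" if "x \<in> carr ?L" "y \<in> carr ?L" for x y
    using leibniz_algebra_L_first[OF n, of \<alpha> \<theta>] that by (simp add: leibniz_algebra_def)
  show ?thesis
    unfolding presents_def
  proof (intro conjI ballI carr)
    fix x y assume "x \<in> coord_space n" "y \<in> coord_space n"
    then show "brk ?L x y \<in> coord_space n" using closed by (simp add: carr)
    show "brk ?L x y 0 = 0" by (rule low)
    let ?h = "coord_series (x 0 + x 1) x"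
    have "coord_series (brk ?L x y 0 + brk ?L x y 1) (brk ?L x y) $ m
        = ((fps_const (y 0) * fps_X + fps_const (y 1) * param_series \<alpha>) * ?h
            + fps_const (y 1 * x 0 * (\<theta> - \<alpha> n)) * fps_X ^ (n - 1)) $ m" if m: "m < n" for m
    proof (cases "m = 0")
      case True
      then show ?thesis using n low by (simp add: coord_series_nth param_series_nth fps_X_power_nth)
    next
      case False
      then have "coord_series (brk ?L x y 0 + brk ?L x y 1) (brk ?L x y) $ m = brk ?L x y (m + 1)"
        by (simp add: coord_series_nth)
      also have "\<dots> = y 0 * ?h $ (m - 1) + y 1 * ((param_series \<alpha> * ?h) $ m
            + (if m = n - 1 then x 0 * (\<theta> - \<alpha> n) else 0))"
        unfolding brk first_table_column_0[OF n] first_table_column_1[OF n m]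
        using False m by (auto simp: coord_series_nth)
      also have "\<dots> = ((fps_const (y 0) * fps_X + fps_const (y 1) * param_series \<alpha>) * ?h
            + fps_const (y 1 * x 0 * (\<theta> - \<alpha> n)) * fps_X ^ (n - 1)) $ m"
        using False by (simp add: distrib_right mult.assoc fps_X_power_nth distrib_left)
      finally show ?thesis .
    qed
    then show "coord_series (brk ?L x y 0 + brk ?L x y 1) (brk ?L x y)
        \<approx>\<^bsub>n\<^esub> (fps_const (y 0) * fps_X + fps_const (y 1) * param_series \<alpha>) * ?h
            + fps_const (y 1 * x 0 * (\<theta> - \<alpha> n)) * fps_X ^ (n - 1)"
      by (simp add: cong_upto_iff_nth)
  qed
qed

lemma presents_L_second:
  assumes n: "4 \<le> n"
  shows "truncated_coords.presents n (\<lambda>v. v 1) (\<lambda>v. coord_series (v 0) v)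
    (L_second n \<beta> \<gamma>) (param_series \<beta>) \<gamma>"
proof -
  interpret truncated_coords n "\<lambda>v. v 1" "\<lambda>v. coord_series (v 0) v"
    "\<lambda>c p i. if i = 0 then p $ 0 else if i = 1 then c else if i \<le> n then p $ (i - 1) else 0"
    "\<lambda>a b. b" "\<lambda>a b. a"
    by (rule truncated_coords_second[OF n])
  let ?L = "L_second n \<beta> \<gamma>" and ?P = "second_table n \<beta> \<gamma>"
  have carr: "carr ?L = coord_space n" by (simp add: L_second_def table_algebra_def)
  have brk: "brk ?L x y k = y 0 * (\<Sum>i\<le>n. x i * ?P i 0 k) + y 1 * (\<Sum>i\<le>n. x i * ?P i 1 k)" for x y k
    unfolding L_second_def using n by (intro table_brk_two_columns) (auto simp: second_table_def)
  have low: "brk ?L x y 0 = 0" "brk ?L x y 1 = 0" for x y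
  proof -
    have "?P i 1 0 = 0" "?P i 1 1 = 0" for i
      using n by (auto simp: second_table_e1_apply)
    then show "brk ?L x y 0 = 0" "brk ?L x y 1 = 0"
      unfolding brk second_table_column_0[OF n] by simp_all
  qed
  have closed: "brk ?L x y \<in> carr ?L" if "x \<in> carr ?L" "y \<in> carr ?L" for x y
    using leibniz_algebra_L_second[OF n, of \<beta> \<gamma>] that by (simp add: leibniz_algebra_def)
  show ?thesis
    unfolding presents_def
  proof (intro conjI ballI carr)
    fix x y assume "x \<in> coord_space n" "y \<in> coord_space n"
    then show "brk ?L x y \<in> coord_space n" using closed by (simp add: carr)
    show "brk ?L x y 1 = 0" by (rule low)
    let ?h = "coord_series (x 0) x"
    have "coord_series (brk ?L x y 0) (brk ?L x y) $ m
        = ((fps_const (y 0) * fps_X + fps_const (y 1) * param_series \<beta>) * ?h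
            + fps_const (y 1 * x 1 * \<gamma>) * fps_X ^ (n - 1)) $ m" if m: "m < n" for m
    proof (cases "m = 0")
      case True
      then show ?thesis using n low by (simp add: coord_series_nth param_series_nth fps_X_power_nth)
    next
      case False
      then have "coord_series (brk ?L x y 0) (brk ?L x y) $ m = brk ?L x y (m + 1)"
        by (simp add: coord_series_nth)
      also have "\<dots> = y 0 * ?h $ (m - 1) + y 1 * ((param_series \<beta> * ?h) $ m
            + (if m = n - 1 then x 1 * \<gamma> else 0))"
        unfolding brk second_table_column_0[OF n] second_table_column_1[OF n m]
        using False m by (auto simp: coord_series_nth)
      also have "\<dots> = ((fps_const (y 0) * fps_X + fps_const (y 1) * param_series \<beta>) * ?h
            + fps_const (y 1 * x 1 * \<gamma>) * fps_X ^ (n - 1)) $ m"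
        using False by (simp add: distrib_right mult.assoc fps_X_power_nth distrib_left)
      finally show ?thesis .
    qed
    then show "coord_series (brk ?L x y 0) (brk ?L x y)
        \<approx>\<^bsub>n\<^esub> (fps_const (y 0) * fps_X + fps_const (y 1) * param_series \<beta>) * ?h
            + fps_const (y 1 * x 1 * \<gamma>) * fps_X ^ (n - 1)"
      by (simp add: cong_upto_iff_nth)
  qed
qed

lemma solve_for_param:
  fixes A y S R :: complex
  assumes "A \<noteq> 0"
  shows "A ^ m * y + S = R \<longleftrightarrow> y = 1 / A ^ m * (R - S)"
  using assms by (auto simp: field_simps)

text \<open>In this family \<open>P = A\<close>, \<open>Q = 0\<close> and \<open>G = D = A + B\<close>. As \<open>Q = 0\<close>, the composition equation has no
  correction; the equation for \<open>\<theta>'\<close> is the one for \<open>\<theta>' - \<alpha>'\<^sub>n\<close> added to the one for \<open>\<alpha>'\<^sub>n\<close>.\<close>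
theorem L_first_isomorphic_iff:
  assumes n: "4 \<le> n"
  shows "L_first n \<alpha> \<theta> \<simeq> L_first n \<alpha>' \<theta>' \<longleftrightarrow>
       (\<exists>A B :: complex. A * (A + B) \<noteq> 0 \<and>
          \<alpha>' 3 = (A + B) / A ^ 2 * \<alpha> 3 \<and>
          (\<forall>t\<in>{4..n}. \<alpha>' t =
             1 / A ^ (t - 1) * ((A + B) * \<alpha> t - (\<Sum>k=3..t-1. S_coeff A B k t \<alpha> * \<alpha>' k))) \<and>
          \<theta>' = 1 / A ^ (n - 1) *
             (A * \<theta> + B * \<alpha> n - (\<Sum>k=3..n-1. S_coeff A B k n \<alpha> * \<alpha>' k)))"
    (is "?iso \<longleftrightarrow> (\<exists>A B. ?cond A B)")
proof -
  interpret truncated_coords n "\<lambda>v. v 0" "\<lambda>v. coord_series (v 0 + v 1) v"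
    "\<lambda>c p i. if i = 0 then c else if i = 1 then p $ 0 - c else if i \<le> n then p $ (i - 1) else 0"
    "\<lambda>a b. a" "\<lambda>a b. b - a"
    by (rule truncated_coords_first[OF n])
  let ?data = "iso_data (param_series \<alpha>') (\<theta>' - \<alpha>' n) (param_series \<alpha>) (\<theta> - \<alpha> n)"
  have linear: "(\<forall>a b. P * a + Q * b = A * a \<and> G * b - (P * a + Q * b) = B * a + D * (b - a))
      \<longleftrightarrow> P = A \<and> Q = 0 \<and> G = D \<and> D = A + B" (is "?lin \<longleftrightarrow> ?sol") for A B D P Q G :: complex
  proof
    assume lin: ?lin
    show ?sol using lin[rule_format, of 1 0] lin[rule_format, of 0 1] by (auto simp: algebra_simps)
  qed (auto simp: algebra_simps)
  have data_iff: "?data A B D P Q G \<longleftrightarrow> P = A \<and> Q = 0 \<and> G = D \<and> D = A + B \<and> ?cond A B"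
    for A B D P Q G
  proof (cases "P = A \<and> Q = 0 \<and> G = D \<and> D = A + B \<and> A \<noteq> 0 \<and> A + B \<noteq> 0")
    case False
    then show ?thesis unfolding iso_data_def linear by auto
  next
    case True
    then have eqs: "P = A" "Q = 0" "G = A + B" "D = A + B" and A: "A \<noteq> 0" and AB: "A + B \<noteq> 0"
      by auto
    let ?S = "\<lambda>t. \<Sum>k=3..t-1. S_coeff A B k t \<alpha> * \<alpha>' k"
    have "?data A B D P Q G \<longleftrightarrow>
        (\<forall>t\<in>{3..n}. A ^ (t - 1) * \<alpha>' t + ?S t = (A + B) * \<alpha> t) \<and>
        (A + B) * (\<theta>' - \<alpha>' n) * A ^ (n - 1) = (A + B) * A * (\<theta> - \<alpha> n)"
      using A AB unfolding iso_data_def linear eqs param_series_compose_cong_iff[OF n]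
      by (simp cong: if_cong)
    also have "{3..n} = insert 3 {4..n}" using n by auto
    also have "((\<forall>t\<in>insert 3 {4..n}. A ^ (t - 1) * \<alpha>' t + ?S t = (A + B) * \<alpha> t) \<and>
        (A + B) * (\<theta>' - \<alpha>' n) * A ^ (n - 1) = (A + B) * A * (\<theta> - \<alpha> n)) \<longleftrightarrow>
        (\<forall>t\<in>insert 3 {4..n}. A ^ (t - 1) * \<alpha>' t + ?S t = (A + B) * \<alpha> t) \<and>
        A ^ (n - 1) * \<theta>' + ?S n = A * \<theta> + B * \<alpha> n" (is "?E \<and> ?F \<longleftrightarrow> ?E \<and> ?F'")
    proof (rule conj_cong[OF refl])
      assume ?E
      then have "A ^ (n - 1) * \<alpha>' n + ?S n = (A + B) * \<alpha> n" using n by simp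
      then have S: "?S n = (A + B) * \<alpha> n - A ^ (n - 1) * \<alpha>' n" by (simp add: algebra_simps)
      have assoc: "(A + B) * (\<theta>' - \<alpha>' n) * A ^ (n - 1) = (A + B) * (A ^ (n - 1) * (\<theta>' - \<alpha>' n))"
        by (simp only: mult_ac)
      have "?F \<longleftrightarrow> A ^ (n - 1) * (\<theta>' - \<alpha>' n) = A * (\<theta> - \<alpha> n)"
        unfolding assoc mult.assoc[of "A + B" A] mult_cancel_left using AB by blast
      also have "\<dots> \<longleftrightarrow> ?F'"
        by (rule diff_eq_diff_eq, unfold S) (simp add: algebra_simps)
      finally show "?F \<longleftrightarrow> ?F'" .
    qed
    also have "\<dots> \<longleftrightarrow> ?cond A B"
      unfolding solve_for_param[OF A] using A AB by simp
    finally show ?thesis using eqs by simp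
  qed
  have "?iso \<longleftrightarrow> (\<exists>A B D P Q G. ?data A B D P Q G)"
    by (rule isomorphic_iff_iso_data[OF presents_L_first[OF n] presents_L_first[OF n]])
      (simp_all add: param_series_nth)
  also have "\<dots> \<longleftrightarrow> (\<exists>A B. ?cond A B)"
  proof
    assume "\<exists>A B D P Q G. ?data A B D P Q G"
    then obtain A B D P Q G where "?data A B D P Q G" by blast
    then have "?cond A B" unfolding data_iff by (elim conjE) (intro conjI)
    then show "\<exists>A B. ?cond A B" by blast
  next
    assume "\<exists>A B. ?cond A B"
    then obtain A B where "?cond A B" by blast
    then have "?data A B (A + B) A 0 (A + B)" unfolding data_iff by (elim conjE) (intro conjI refl)
    then show "\<exists>A B D P Q G. ?data A B D P Q G" by blast
  qed
  finally show ?thesis .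
qed

text \<open>In this family \<open>P = D\<close>, \<open>Q = B\<close> and \<open>G = A\<close>, with \<open>D\<close> free. The correction of the composition
  equation is the term \<open>B D \<gamma> / A\<^sup>n\<close> in the formula for \<open>\<beta>'\<^sub>n\<close>.\<close>
theorem L_second_isomorphic_iff:
  assumes n: "4 \<le> n"
  shows "L_second n \<beta> \<gamma> \<simeq> L_second n \<beta>' \<gamma>' \<longleftrightarrow>
       (\<exists>A B D :: complex. A * D \<noteq> 0 \<and>
          \<gamma>' = D ^ 2 / A ^ n * \<gamma> \<and>
          \<beta>' 3 = D / A ^ 2 * \<beta> 3 \<and>
          (\<forall>t\<in>{4..n-1}. \<beta>' t =
             1 / A ^ (t - 1) * (D * \<beta> t - (\<Sum>k=3..t-1. S_coeff A B k t \<beta> * \<beta>' k))) \<and>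
          \<beta>' n = B * D * \<gamma> / A ^ n +
             1 / A ^ (n - 1) * (D * \<beta> n - (\<Sum>k=3..n-1. S_coeff A B k n \<beta> * \<beta>' k)))"
    (is "?iso \<longleftrightarrow> (\<exists>A B D. ?cond A B D)")
proof -
  interpret truncated_coords n "\<lambda>v. v 1" "\<lambda>v. coord_series (v 0) v"
    "\<lambda>c p i. if i = 0 then p $ 0 else if i = 1 then c else if i \<le> n then p $ (i - 1) else 0"
    "\<lambda>a b. b" "\<lambda>a b. a"
    by (rule truncated_coords_second[OF n])
  let ?data = "iso_data (param_series \<beta>') \<gamma>' (param_series \<beta>) \<gamma>"
  have linear: "(\<forall>a b. G * b = A * b \<and> P * a + Q * b = B * b + D * a)
      \<longleftrightarrow> P = D \<and> Q = B \<and> G = A" (is "?lin \<longleftrightarrow> ?sol") for A B D P Q G :: complex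
  proof
    assume lin: ?lin
    show ?sol using lin[rule_format, of 1 0] lin[rule_format, of 0 1] by auto
  qed (auto simp: algebra_simps)
  have data_iff: "?data A B D P Q G \<longleftrightarrow> P = D \<and> Q = B \<and> G = A \<and> ?cond A B D" for A B D P Q G
  proof (cases "P = D \<and> Q = B \<and> G = A \<and> A \<noteq> 0 \<and> D \<noteq> 0")
    case False
    then show ?thesis unfolding iso_data_def linear by auto
  next
    case True
    then have eqs: "P = D" "Q = B" "G = A" and A: "A \<noteq> 0" and D: "D \<noteq> 0" by auto
    let ?S = "\<lambda>t. \<Sum>k=3..t-1. S_coeff A B k t \<beta> * \<beta>' k"
    have An: "A ^ n = A * A ^ (n - 1)" using n by (cases n) auto
    have "?data A B D P Q G \<longleftrightarrow>
        (\<forall>t\<in>{3..n}. A ^ (t - 1) * \<beta>' t + ?S t = D * \<beta> t + (if t = n then D * B * \<gamma> / A else 0)) \<and>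
        A * \<gamma>' * A ^ (n - 1) = D * D * \<gamma>"
      using A D unfolding iso_data_def linear eqs param_series_compose_cong_iff[OF n] by simp
    also have "{3..n} = insert n (insert 3 {4..n-1})" using n by auto
    also have "(\<forall>t\<in>insert n (insert 3 {4..n-1}).
          A ^ (t - 1) * \<beta>' t + ?S t = D * \<beta> t + (if t = n then D * B * \<gamma> / A else 0)) \<longleftrightarrow>
        A ^ (n - 1) * \<beta>' n + ?S n = D * \<beta> n + D * B * \<gamma> / A \<and>
        A ^ (3 - 1) * \<beta>' 3 + ?S 3 = D * \<beta> 3 \<and>
        (\<forall>t\<in>{4..n-1}. A ^ (t - 1) * \<beta>' t + ?S t = D * \<beta> t)"
    proof -
      have "(\<forall>t\<in>{4..n-1}.
            A ^ (t - 1) * \<beta>' t + ?S t = D * \<beta> t + (if t = n then D * B * \<gamma> / A else 0)) \<longleftrightarrow>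
          (\<forall>t\<in>{4..n-1}. A ^ (t - 1) * \<beta>' t + ?S t = D * \<beta> t)"
        using n by (intro ball_cong refl) auto
      then show ?thesis unfolding Set.ball_simps(7) using n by (simp only:) simp
    qed
    also have "A ^ (n - 1) * \<beta>' n + ?S n = D * \<beta> n + D * B * \<gamma> / A \<longleftrightarrow>
        \<beta>' n = B * D * \<gamma> / A ^ n + 1 / A ^ (n - 1) * (D * \<beta> n - ?S n)"
    proof -
      have "1 / A ^ (n - 1) * (D * \<beta> n + D * B * \<gamma> / A - s)
          = B * D * \<gamma> / A ^ n + 1 / A ^ (n - 1) * (D * \<beta> n - s)" for s
        unfolding An using A by (simp add: field_simps)
      then show ?thesis unfolding solve_for_param[OF A] by (simp only:)
    qed
    also have "A ^ (3 - 1) * \<beta>' 3 + ?S 3 = D * \<beta> 3 \<longleftrightarrow> \<beta>' 3 = D / A ^ 2 * \<beta> 3"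
      unfolding solve_for_param[OF A] by simp
    also have "A * \<gamma>' * A ^ (n - 1) = D * D * \<gamma> \<longleftrightarrow> \<gamma>' = D ^ 2 / A ^ n * \<gamma>"
      using A unfolding An by (auto simp: field_simps power2_eq_square)
    finally have "?data A B D P Q G \<longleftrightarrow> (\<beta>' n = B * D * \<gamma> / A ^ n + 1 / A ^ (n - 1) * (D * \<beta> n - ?S n) \<and>
        \<beta>' 3 = D / A ^ 2 * \<beta> 3 \<and>
        (\<forall>t\<in>{4..n-1}. \<beta>' t = 1 / A ^ (t - 1) * (D * \<beta> t - ?S t))) \<and> \<gamma>' = D ^ 2 / A ^ n * \<gamma>"
      unfolding solve_for_param[OF A] .
    moreover have "A * D \<noteq> 0" using A D by simp
    ultimately show ?thesis using eqs by blast
  qed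
  have "?iso \<longleftrightarrow> (\<exists>A B D P Q G. ?data A B D P Q G)"
    by (rule isomorphic_iff_iso_data[OF presents_L_second[OF n] presents_L_second[OF n]])
      (simp_all add: param_series_nth)
  also have "\<dots> \<longleftrightarrow> (\<exists>A B D. ?cond A B D)"
  proof
    assume "\<exists>A B D P Q G. ?data A B D P Q G"
    then obtain A B D P Q G where "?data A B D P Q G" by blast
    then have "?cond A B D" unfolding data_iff by (elim conjE) (intro conjI)
    then show "\<exists>A B D. ?cond A B D" by blast
  next
    assume "\<exists>A B D. ?cond A B D"
    then obtain A B D where "?cond A B D" by blast
    then have "?data A B D D B A" unfolding data_iff by (elim conjE) (intro conjI refl)
    then show "\<exists>A B D P Q G. ?data A B D P Q G" by blast
  qed
  finally show ?thesis .
qed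

theorem theorem4p4:
  fixes n :: nat
    and \<alpha> \<alpha>' \<beta> \<beta>' :: "nat \<Rightarrow> complex"
    and \<theta> \<theta>' \<gamma> \<gamma>' :: complex
  assumes "n \<ge> 4"
  shows
    "(L_first n \<alpha> \<theta> \<simeq> L_first n \<alpha>' \<theta>' \<longleftrightarrow>
       (\<exists>A B :: complex. A * (A + B) \<noteq> 0 \<and>
          \<alpha>' 3 = (A + B) / A ^ 2 * \<alpha> 3 \<and>
          (\<forall>t\<in>{4..n}. \<alpha>' t =
             1 / A ^ (t - 1) * ((A + B) * \<alpha> t - (\<Sum>k=3..t-1. S_coeff A B k t \<alpha> * \<alpha>' k))) \<and>
          \<theta>' = 1 / A ^ (n - 1) *
             (A * \<theta> + B * \<alpha> n - (\<Sum>k=3..n-1. S_coeff A B k n \<alpha> * \<alpha>' k))))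
     \<and>
     (L_second n \<beta> \<gamma> \<simeq> L_second n \<beta>' \<gamma>' \<longleftrightarrow>
       (\<exists>A B D :: complex. A * D \<noteq> 0 \<and>
          \<gamma>' = D ^ 2 / A ^ n * \<gamma> \<and>
          \<beta>' 3 = D / A ^ 2 * \<beta> 3 \<and>
          (\<forall>t\<in>{4..n-1}. \<beta>' t =
             1 / A ^ (t - 1) * (D * \<beta> t - (\<Sum>k=3..t-1. S_coeff A B k t \<beta> * \<beta>' k))) \<and>
          \<beta>' n = B * D * \<gamma> / A ^ n +
             1 / A ^ (n - 1) * (D * \<beta> n - (\<Sum>k=3..n-1. S_coeff A B k n \<beta> * \<beta>' k))))"
  by (rule conjI[OF L_first_isomorphic_iff[OF assms] L_second_isomorphic_iff[OF assms]])

end
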